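(* $L(\Omega,\bullet)$ and $\bar{L}(\Omega,\bullet)$ define functors $\mathbf{Simp}\to\mathbf{Met}_1$ and $\mathbf{Simp}\to\mathbf{CMet}_1$ respectively, with the property that $\bar{L}(\Omega,\bullet)=Comp\circ L(\Omega,\bullet)$.
   Context: $(\Omega,\lambda)$ is a nonatomic standard probability space. For a set $S$, endowed with the discrete metric ($d(s,s')=1$ if $s\neq s'$) and its Borel $\sigma$-algebra (all subsets), $L(\Omega,S)$ is the set of measurable maps $\Omega\to S$ modulo almost everywhere equality, with the metric $d(f,g)=\lambda(\{t : f(t)\neq g(t)\})$. The essential image of $f\in L(\Omega,S)$ is $f(\Omega)=\{s\in S : \lambda(f^{-1}(\{s\}))>0\}$. A simplicial complex is a collection $\mathcal{K}$ of nonempty finite sets such that every nonempty subset of an element of $\mathcal{K}$ is in $\mathcal{K}$; its vertex set is $\bigcup\mathcal{K}$. With $S=\bigcup\mathcal{K}$, $L(\Omega,\mathcal{K})=\{f\in L(\Omega,S) : f(\Omega)\in\mathcal{K}\}$ and $\bar{L}(\Omega,\mathcal{K})$ is its closure in $L(\Omega,S)$, both with the induced metric. $\mathbf{Simp}$ is the category of simplicial complexes, a morphism $\varphi:\mathcal{K}_1\to\mathcal{K}_2$ being a map $\varphi:\bigcup\mathcal{K}_1\to\bigcup\mathcal{K}_2$ such that $\varphi(F)\in\mathcal{K}_2$ for all $F\in\mathcal{K}_1$. $\mathbf{Met}_1$ is the category of metric spaces of diameter at most $1$ with contracting maps, i.e. maps $f$ with $d(f(a),f(b))\leq d(a,b)$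 for all $a,b$; $\mathbf{CMet}_1$ is its full subcategory of complete metric spaces; $Comp:\mathbf{Met}_1\to\mathbf{CMet}_1$ is the completion functor. On morphisms, the functors $L(\Omega,\bullet)$ and $\bar{L}(\Omega,\bullet)$ send $\varphi$ to $f\mapsto\varphi\circ f$. *)

theory Defs
  imports "HOL-Probability.Probability"
begin

section \<open>Nonatomic standard probability spaces\<close>

text \<open>
  Up to a null set, the \<open>\<sigma>\<close>-algebra lies between the Borel \<open>\<sigma>\<close>-algebra of a Polish topology and its
  completion. This covers standard Borel spaces with a Borel probability measure, their completions
  (such as Lebesgue measure on the unit interval), and spaces that become one of these after removal
  of a null set, as in Rokhlin's definition.
\<close>

definition standard_prob_space :: "'a measure \<Rightarrow> bool" where
  "standard_prob_space M \<longleftrightarrow>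
     prob_space M \<and>
     (\<exists>T. completely_metrizable_space T \<and> second_countable T \<and>
          space M - topspace T \<in> null_sets M \<and>
          (let B = sigma (topspace T) {U. openin T U} in
             sets B \<subseteq> sets M \<and>
             (\<forall>A\<in>sets M. \<exists>A1\<in>sets B. \<exists>A2\<in>sets B.
                A1 \<subseteq> A \<inter> topspace T \<and> A \<inter> topspace T \<subseteq> A2 \<and> emeasure M (A2 - A1) = 0)))"

definition nonatomic :: "'a measure \<Rightarrow> bool" where
  "nonatomic M \<longleftrightarrow>
     (\<forall>A\<in>sets M. emeasure M A > 0 \<longrightarrow>
        (\<exists>B\<in>sets M. B \<subseteq> A \<and> 0 < emeasure M B \<and> emeasure M B < emeasure M A))"


section \<open>Categories and functors\<close>

text \<open>
  Categories are given by hom-sets, which need not be disjoint; composition and the action of a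
  functor on morphisms therefore take the objects involved as arguments.
  \<open>cat_comp C X Y Z g f\<close> is the composite of \<open>f\<close> from \<open>X\<close> to \<open>Y\<close> followed by \<open>g\<close> from \<open>Y\<close> to \<open>Z\<close>.
\<close>

record ('o, 'm) cat =
  cat_ob :: "'o set"
  cat_hom :: "'o \<Rightarrow> 'o \<Rightarrow> 'm set"
  cat_id :: "'o \<Rightarrow> 'm"
  cat_comp :: "'o \<Rightarrow> 'o \<Rightarrow> 'o \<Rightarrow> 'm \<Rightarrow> 'm \<Rightarrow> 'm"

definition category :: "('o, 'm) cat \<Rightarrow> bool" where
  "category C \<longleftrightarrow>
     (\<forall>X\<in>cat_ob C. cat_id C X \<in> cat_hom C X X) \<and>
     (\<forall>X\<in>cat_ob C. \<forall>Y\<in>cat_ob C. \<forall>Z\<in>cat_ob C. \<forall>f\<in>cat_hom C X Y. \<forall>g\<in>cat_hom C Y Z.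
        cat_comp C X Y Z g f \<in> cat_hom C X Z) \<and>
     (\<forall>X\<in>cat_ob C. \<forall>Y\<in>cat_ob C. \<forall>f\<in>cat_hom C X Y.
        cat_comp C X X Y f (cat_id C X) = f \<and> cat_comp C X Y Y (cat_id C Y) f = f) \<and>
     (\<forall>W\<in>cat_ob C. \<forall>X\<in>cat_ob C. \<forall>Y\<in>cat_ob C. \<forall>Z\<in>cat_ob C.
        \<forall>f\<in>cat_hom C W X. \<forall>g\<in>cat_hom C X Y. \<forall>h\<in>cat_hom C Y Z.
        cat_comp C W X Z (cat_comp C X Y Z h g) f = cat_comp C W Y Z h (cat_comp C W X Y g f))"

record ('o1, 'm1, 'o2, 'm2) functr =
  fun_ob :: "'o1 \<Rightarrow> 'o2"
  fun_mor :: "'o1 \<Rightarrow> 'o1 \<Rightarrow> 'm1 \<Rightarrow> 'm2"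

definition is_functor ::
    "('o1, 'm1) cat \<Rightarrow> ('o2, 'm2) cat \<Rightarrow> ('o1, 'm1, 'o2, 'm2) functr \<Rightarrow> bool" where
  "is_functor C D F \<longleftrightarrow>
     category C \<and> category D \<and>
     (\<forall>X\<in>cat_ob C. fun_ob F X \<in> cat_ob D) \<and>
     (\<forall>X\<in>cat_ob C. \<forall>Y\<in>cat_ob C. \<forall>f\<in>cat_hom C X Y.
        fun_mor F X Y f \<in> cat_hom D (fun_ob F X) (fun_ob F Y)) \<and>
     (\<forall>X\<in>cat_ob C. fun_mor F X X (cat_id C X) = cat_id D (fun_ob F X)) \<and>
     (\<forall>X\<in>cat_ob C. \<forall>Y\<in>cat_ob C. \<forall>Z\<in>cat_ob C. \<forall>f\<in>cat_hom C X Y. \<forall>g\<in>cat_hom C Y Z.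
        fun_mor F X Z (cat_comp C X Y Z g f) =
        cat_comp D (fun_ob F X) (fun_ob F Y) (fun_ob F Z) (fun_mor F Y Z g) (fun_mor F X Y f))"

definition functor_comp ::
    "('o2, 'm2, 'o3, 'm3) functr \<Rightarrow> ('o1, 'm1, 'o2, 'm2) functr \<Rightarrow> ('o1, 'm1, 'o3, 'm3) functr" where
  "functor_comp G F =
     \<lparr> fun_ob = (\<lambda>X. fun_ob G (fun_ob F X)),
       fun_mor = (\<lambda>X Y f. fun_mor G (fun_ob F X) (fun_ob F Y) (fun_mor F X Y f)) \<rparr>"


section \<open>Simplicial complexes\<close>

definition abstract_complex :: "'v set set \<Rightarrow> bool" where
  "abstract_complex K \<longleftrightarrow>
     (\<forall>F\<in>K. finite F \<and> F \<noteq> {}) \<and> (\<forall>F\<in>K. \<forall>G. G \<noteq> {} \<and> G \<subseteq> F \<longrightarrow> G \<in> K)"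

text \<open>The type of vertices is an arbitrary universe; maps are made extensional so that equality of
  morphisms is equality of maps on the vertex set.\<close>

definition Simp :: "('v set set, 'v \<Rightarrow> 'v) cat" where
  "Simp =
     \<lparr> cat_ob = {K. abstract_complex K},
       cat_hom = (\<lambda>K1 K2. {\<phi> \<in> \<Union>K1 \<rightarrow>\<^sub>E \<Union>K2. \<forall>F\<in>K1. \<phi> ` F \<in> K2}),
       cat_id = (\<lambda>K. restrict id (\<Union>K)),
       cat_comp = (\<lambda>K1 K2 K3 \<psi> \<phi>. compose (\<Union>K1) \<psi> \<phi>) \<rparr>"


section \<open>Metric spaces of diameter at most one\<close>

type_synonym 'x mspc = "'x set \<times> ('x \<Rightarrow> 'x \<Rightarrow> real)"

definition contracting_maps :: "'x mspc \<Rightarrow> 'y mspc \<Rightarrow> ('x \<Rightarrow> 'y) set" where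
  "contracting_maps X Y =
     {f \<in> fst X \<rightarrow>\<^sub>E fst Y. \<forall>a\<in>fst X. \<forall>b\<in>fst X. snd Y (f a) (f b) \<le> snd X a b}"

definition Met1 :: "('x mspc, 'x \<Rightarrow> 'x) cat" where
  "Met1 =
     \<lparr> cat_ob = {X. Metric_space (fst X) (snd X) \<and> (\<forall>a\<in>fst X. \<forall>b\<in>fst X. snd X a b \<le> 1)},
       cat_hom = contracting_maps,
       cat_id = (\<lambda>X. restrict id (fst X)),
       cat_comp = (\<lambda>X Y Z g f. compose (fst X) g f) \<rparr>"

definition CMet1 :: "('x mspc, 'x \<Rightarrow> 'x) cat" where
  "CMet1 = Met1 \<lparr> cat_ob := {X \<in> cat_ob Met1. Metric_space.mcomplete (fst X) (snd X)} \<rparr>"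

text \<open>
  Natural isomorphism, through contracting maps with contracting inverses, of two functors into
  metric spaces whose points may live in different types. Completions are determined only up to a
  canonical isometry, so an identity of functors involving the completion functor is understood as
  such an isomorphism, compatible with the canonical embeddings.
\<close>

definition natural_isometry ::
    "('o, 'm) cat \<Rightarrow> ('o, 'm, 'x mspc, 'x \<Rightarrow> 'x) functr \<Rightarrow> ('o, 'm, 'y mspc, 'y \<Rightarrow> 'y) functr
       \<Rightarrow> ('o \<Rightarrow> 'x \<Rightarrow> 'y) \<Rightarrow> bool" where
  "natural_isometry C F G \<theta> \<longleftrightarrow>
     (\<forall>A\<in>cat_ob C. \<theta> A \<in> contracting_maps (fun_ob F A) (fun_ob G A) \<and>
        (\<exists>\<eta>\<in>contracting_maps (fun_ob G A) (fun_ob F A).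
           compose (fst (fun_ob F A)) \<eta> (\<theta> A) = restrict id (fst (fun_ob F A)) \<and>
           compose (fst (fun_ob G A)) (\<theta> A) \<eta> = restrict id (fst (fun_ob G A)))) \<and>
     (\<forall>A\<in>cat_ob C. \<forall>B\<in>cat_ob C. \<forall>f\<in>cat_hom C A B.
        compose (fst (fun_ob F A)) (\<theta> B) (fun_mor F A B f) =
        compose (fst (fun_ob F A)) (fun_mor G A B f) (\<theta> A))"


section \<open>The completion functor\<close>

text \<open>Points of the completion are classes of Cauchy sequences.\<close>

definition cauchy_rel :: "'x mspc \<Rightarrow> ((nat \<Rightarrow> 'x) \<times> (nat \<Rightarrow> 'x)) set" where
  "cauchy_rel X =
     {(\<sigma>, \<tau>). Metric_space.MCauchy (fst X) (snd X) \<sigma> \<and> Metric_space.MCauchy (fst X) (snd X) \<tau> \<and>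
        (\<lambda>n. snd X (\<sigma> n) (\<tau> n)) \<longlonglongrightarrow> 0}"

definition completion_points :: "'x mspc \<Rightarrow> (nat \<Rightarrow> 'x) set set" where
  "completion_points X = {\<sigma>. Metric_space.MCauchy (fst X) (snd X) \<sigma>} // cauchy_rel X"

text \<open>The value \<open>0\<close> outside the carrier only serves the convention of the locale
  \<open>Metric_space\<close>, where distances are nonnegative and symmetric on the whole type.\<close>

definition completion_dist ::
    "'x mspc \<Rightarrow> (nat \<Rightarrow> 'x) set \<Rightarrow> (nat \<Rightarrow> 'x) set \<Rightarrow> real" where
  "completion_dist X P Q =
     (if P \<in> completion_points X \<and> Q \<in> completion_points X
      then lim (\<lambda>n. snd X ((SOME \<sigma>. \<sigma> \<in> P) n) ((SOME \<tau>. \<tau> \<in> Q) n)) else 0)"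

definition completion_functor ::
    "('x mspc, 'x \<Rightarrow> 'x, (nat \<Rightarrow> 'x) set mspc, (nat \<Rightarrow> 'x) set \<Rightarrow> (nat \<Rightarrow> 'x) set) functr" where
  "completion_functor =
     \<lparr> fun_ob = (\<lambda>X. (completion_points X, completion_dist X)),
       fun_mor = (\<lambda>X Y f. \<lambda>P\<in>completion_points X. cauchy_rel Y `` ((\<lambda>\<sigma>. f \<circ> \<sigma>) ` P)) \<rparr>"

definition completion_embedding :: "'x mspc \<Rightarrow> 'x \<Rightarrow> (nat \<Rightarrow> 'x) set" where
  "completion_embedding X x = cauchy_rel X `` {\<lambda>n. x}"


section \<open>The spaces of random simplices\<close>

definition ae_rel :: "'a measure \<Rightarrow> 'v set \<Rightarrow> (('a \<Rightarrow> 'v) \<times> ('a \<Rightarrow> 'v)) set" where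
  "ae_rel M S =
     {(f, g). f \<in> M \<rightarrow>\<^sub>M count_space S \<and> g \<in> M \<rightarrow>\<^sub>M count_space S \<and> (AE t in M. f t = g t)}"

definition L_set :: "'a measure \<Rightarrow> 'v set \<Rightarrow> ('a \<Rightarrow> 'v) set set" where
  "L_set M S = (M \<rightarrow>\<^sub>M count_space S) // ae_rel M S"

text \<open>
  For uncountable \<open>S\<close> the diagonal need not be measurable for the product \<open>\<sigma>\<close>-algebra, hence the
  completion of the measure, which agrees with it on all measurable sets.
\<close>

definition L_dist :: "'a measure \<Rightarrow> ('a \<Rightarrow> 'v) set \<Rightarrow> ('a \<Rightarrow> 'v) set \<Rightarrow> real" where
  "L_dist M P Q =
     measure (completion M) {t \<in> space M. (SOME f. f \<in> P) t \<noteq> (SOME g. g \<in> Q) t}"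

definition ess_image :: "'a measure \<Rightarrow> ('a \<Rightarrow> 'v) \<Rightarrow> 'v set" where
  "ess_image M f = {s. measure M (f -` {s} \<inter> space M) > 0}"

definition L_complex :: "'a measure \<Rightarrow> 'v set set \<Rightarrow> ('a \<Rightarrow> 'v) set set" where
  "L_complex M K = {P \<in> L_set M (\<Union>K). \<exists>f\<in>P. ess_image M f \<in> K}"

definition Lbar_complex :: "'a measure \<Rightarrow> 'v set set \<Rightarrow> ('a \<Rightarrow> 'v) set set" where
  "Lbar_complex M K =
     (Metric_space.mtopology (L_set M (\<Union>K)) (L_dist M)) closure_of (L_complex M K)"

definition postcompose ::
    "'a measure \<Rightarrow> 'v set \<Rightarrow> ('v \<Rightarrow> 'v) \<Rightarrow> ('a \<Rightarrow> 'v) set \<Rightarrow> ('a \<Rightarrow> 'v) set" where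
  "postcompose M S \<phi> P = ae_rel M S `` ((\<lambda>f. \<phi> \<circ> f) ` P)"

definition L_functor ::
    "'a measure \<Rightarrow>
     ('v set set, 'v \<Rightarrow> 'v, ('a \<Rightarrow> 'v) set mspc, ('a \<Rightarrow> 'v) set \<Rightarrow> ('a \<Rightarrow> 'v) set) functr" where
  "L_functor M =
     \<lparr> fun_ob = (\<lambda>K. (L_complex M K, L_dist M)),
       fun_mor = (\<lambda>K1 K2 \<phi>. restrict (postcompose M (\<Union>K2) \<phi>) (L_complex M K1)) \<rparr>"

definition Lbar_functor ::
    "'a measure \<Rightarrow>
     ('v set set, 'v \<Rightarrow> 'v, ('a \<Rightarrow> 'v) set mspc, ('a \<Rightarrow> 'v) set \<Rightarrow> ('a \<Rightarrow> 'v) set) functr" where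
  "Lbar_functor M =
     \<lparr> fun_ob = (\<lambda>K. (Lbar_complex M K, L_dist M)),
       fun_mor = (\<lambda>K1 K2 \<phi>. restrict (postcompose M (\<Union>K2) \<phi>) (Lbar_complex M K1)) \<rparr>"

end

theory Submission
  imports Defs
begin

text \<open>
  Post-composition with a simplicial map contracts \<open>L(\<Omega>, S)\<close> because \<open>\<phi> \<circ> f\<close> and \<open>\<phi> \<circ> g\<close> differ only
  where \<open>f\<close> and \<open>g\<close> do. It preserves random simplices because a measurable map into a discrete space
  is almost everywhere in its essential image, so that the essential image of \<open>\<phi> \<circ> f\<close> is the image
  under \<open>\<phi>\<close> of that of \<open>f\<close>. For uncountable \<open>S\<close> this is a property of standard spaces: a map all of
  whose fibres are null could be turned, by means of its distribution function, into a map to the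
  unit interval that carries the measure to Lebesgue measure and under which the preimage of every
  subset is measurable; tightness and Lusin's argument then produce a compact non-null subset of a
  Vitali set.

  The metric space \<open>L(\<Omega>, S)\<close> is complete by the Borel-Cantelli argument, hence the closure of the
  random simplices is a model of their completion: a class of Cauchy sequences corresponds to their
  common limit. Functoriality of the completion is transported along this correspondence.
\<close>

text \<open>With countably many vertices, a union of null fibres is plainly null. With uncountably
  many, the pushforward of the measure lives on all subsets of \<open>S\<close>, and countable
  additivity alone gives no contradiction when it vanishes at points: a real-valued measurable
  cardinal would carry such a measure. The contradiction has to come from compact inner regularity
  of the domain. This is why topology enters at all, and why Vitali sets are met only through their
  compact subsets. The vertices form an arbitrary set, but those that a map takes on a Polish space
  can be coded injectively by reals, through a chosen preimage. Such a code may be wild as a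
  function, yet every function on a discrete space is measurable. The same device makes disagreement
  sets measurable for the completed measure.\<close>

section \<open>Completions inside a complete space\<close>

text \<open>For \<open>l\<close> in the closure of \<open>A\<close>, this set of sequences is a point of the completion of \<open>A\<close>.\<close>

definition (in Submetric) seqs_to :: "'a \<Rightarrow> (nat \<Rightarrow> 'a) set" where
  "seqs_to l = {\<sigma>. range \<sigma> \<subseteq> A \<and> limitin mtopology \<sigma> l sequentially}"

context Submetric
begin

text \<open>Triangle inequalities bound the error by
  \<open>d (\<sigma> n) l + d (\<tau> n) m\<close>. Both the equivalence of sequences and the
  distance of the completion are read off from this limit.\<close>

lemma tendsto_dist_seqs_to:
  "\<lbrakk>\<sigma> \<in> seqs_to l; \<tau> \<in> seqs_to m\<rbrakk> \<Longrightarrow> (\<lambda>n. d (\<sigma> n) (\<tau> n)) \<longlonglongrightarrow> d l m"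
proof -
  assume \<sigma>: "\<sigma> \<in> seqs_to l" and \<tau>: "\<tau> \<in> seqs_to m"
  then have lm: "l \<in> M" "m \<in> M" and in_M: "\<sigma> n \<in> M" "\<tau> n \<in> M" for n
    using subset by (auto simp: seqs_to_def limitin_mspace range_subsetD subsetD)
  have lims: "(\<lambda>n. d (\<sigma> n) l) \<longlonglongrightarrow> 0" "(\<lambda>n. d (\<tau> n) m) \<longlonglongrightarrow> 0"
    using \<sigma> \<tau> by (auto simp: seqs_to_def limitin_metric_dist_null)
  have "\<bar>d (\<sigma> n) (\<tau> n) - d l m\<bar> \<le> d (\<sigma> n) l + d (\<tau> n) m" for n
  proof -
    have "d (\<sigma> n) (\<tau> n) \<le> d (\<sigma> n) l + d l (\<tau> n)" "d l (\<tau> n) \<le> d l m + d m (\<tau> n)"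
      "d l m \<le> d l (\<sigma> n) + d (\<sigma> n) m" "d (\<sigma> n) m \<le> d (\<sigma> n) (\<tau> n) + d (\<tau> n) m"
      using lm in_M by (blast intro: triangle)+
    moreover have "d l (\<sigma> n) = d (\<sigma> n) l" "d m (\<tau> n) = d (\<tau> n) m"
      by (rule commute)+
    ultimately show ?thesis
      by linarith
  qed
  then have "\<forall>\<^sub>F n in sequentially. norm (d (\<sigma> n) (\<tau> n) - d l m) \<le> d (\<sigma> n) l + d (\<tau> n) m"
    unfolding real_norm_def by (rule always_eventually[OF allI])
  from Lim_null_comparison[OF this tendsto_add_zero[OF lims]]
  have "(\<lambda>n. d (\<sigma> n) (\<tau> n) - d l m) \<longlonglongrightarrow> 0" .
  then show ?thesis
    by (rule LIM_zero_cancel)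
qed

lemma MCauchy_seqs_to: "\<sigma> \<in> seqs_to l \<Longrightarrow> sub.MCauchy \<sigma>"
  unfolding seqs_to_def MCauchy_submetric using subset convergent_imp_MCauchy by blast

lemma MCauchy_iff_seqs_to:
  assumes "mcomplete"
  shows "sub.MCauchy \<sigma> \<longleftrightarrow> (\<exists>l \<in> mtopology closure_of A. \<sigma> \<in> seqs_to l)"
proof
  assume \<sigma>: "sub.MCauchy \<sigma>"
  then obtain l where l: "limitin mtopology \<sigma> l sequentially" "range \<sigma> \<subseteq> A"
    using assms unfolding mcomplete_def by (meson MCauchy_submetric)
  then have "l \<in> mtopology closure_of A"
    using limitin_mspace subset by (auto simp: closure_of_sequentially intro!: exI[of _ \<sigma>])
  then show "\<exists>l \<in> mtopology closure_of A. \<sigma> \<in> seqs_to l"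
    using l by (auto simp: seqs_to_def)
qed (auto intro: MCauchy_seqs_to)

lemma seqs_to_nonempty: "l \<in> mtopology closure_of A \<Longrightarrow> seqs_to l \<noteq> {}"
  unfolding closure_of_sequentially seqs_to_def by blast

lemma seqs_to_in_space: "\<sigma> \<in> seqs_to l \<Longrightarrow> l \<in> M"
  by (auto simp: seqs_to_def limitin_mspace)

lemma inj_on_seqs_to: "inj_on seqs_to (mtopology closure_of A)"
proof (rule inj_onI)
  fix l m assume "l \<in> mtopology closure_of A" and eq: "seqs_to l = seqs_to m"
  then obtain \<sigma> where "\<sigma> \<in> seqs_to l" "\<sigma> \<in> seqs_to m"
    using seqs_to_nonempty[of l] by auto
  then show "l = m"
    using limitin_metric_unique by (fastforce simp: seqs_to_def)
qed

text \<open>The distances of equivalent sequences tend to 0 but also to the distance of the limits,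
  so the limits agree. A limit thus labels a whole class, whatever the representative.\<close>

lemma cauchy_rel_seqs_to:
  assumes "mcomplete" and "\<sigma> \<in> seqs_to l"
  shows "cauchy_rel (A, d) `` {\<sigma>} = seqs_to l"
proof (intro set_eqI iffI)
  fix \<tau> assume "\<tau> \<in> cauchy_rel (A, d) `` {\<sigma>}"
  then have \<tau>: "sub.MCauchy \<tau>" "(\<lambda>n. d (\<sigma> n) (\<tau> n)) \<longlonglongrightarrow> 0"
    by (auto simp: cauchy_rel_def)
  then obtain m where m: "\<tau> \<in> seqs_to m"
    using MCauchy_iff_seqs_to[OF assms(1)] by auto
  then have "d l m = 0"
    using LIMSEQ_unique[OF tendsto_dist_seqs_to[OF assms(2) m] \<tau>(2)] by simp
  then show "\<tau> \<in> seqs_to l"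
    using m seqs_to_in_space[OF m] seqs_to_in_space[OF assms(2)] by simp
next
  fix \<tau> assume \<tau>: "\<tau> \<in> seqs_to l"
  have "(\<lambda>n. d (\<sigma> n) (\<tau> n)) \<longlonglongrightarrow> 0"
    using tendsto_dist_seqs_to[OF assms(2) \<tau>] seqs_to_in_space[OF \<tau>] by simp
  then show "\<tau> \<in> cauchy_rel (A, d) `` {\<sigma>}"
    using MCauchy_seqs_to[OF \<tau>] MCauchy_seqs_to[OF assms(2)]
    by (simp add: cauchy_rel_def)
qed

lemma completion_points_eq:
  assumes "mcomplete"
  shows "completion_points (A, d) = seqs_to ` (mtopology closure_of A)"
proof -
  have "completion_points (A, d) = (\<lambda>\<sigma>. cauchy_rel (A, d) `` {\<sigma>}) ` {\<sigma>. sub.MCauchy \<sigma>}"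
    unfolding completion_points_def quotient_def fst_conv snd_conv by blast
  also have "\<dots> = seqs_to ` (mtopology closure_of A)"
  proof (rule antisym; rule subsetI)
    fix P assume "P \<in> (\<lambda>\<sigma>. cauchy_rel (A, d) `` {\<sigma>}) ` {\<sigma>. sub.MCauchy \<sigma>}"
    then obtain \<sigma> where P: "P = cauchy_rel (A, d) `` {\<sigma>}" and "sub.MCauchy \<sigma>"
      by blast
    then obtain l where l: "l \<in> mtopology closure_of A" "\<sigma> \<in> seqs_to l"
      using MCauchy_iff_seqs_to[OF assms] by blast
    show "P \<in> seqs_to ` (mtopology closure_of A)"
      unfolding P cauchy_rel_seqs_to[OF assms l(2)] using l(1) by (rule imageI)
  next
    fix P assume "P \<in> seqs_to ` (mtopology closure_of A)"
    then obtain l where P: "P = seqs_to l" and "l \<in> mtopology closure_of A"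
      by blast
    then obtain \<sigma> where \<sigma>: "\<sigma> \<in> seqs_to l"
      using seqs_to_nonempty by blast
    show "P \<in> (\<lambda>\<sigma>. cauchy_rel (A, d) `` {\<sigma>}) ` {\<sigma>. sub.MCauchy \<sigma>}"
      unfolding P cauchy_rel_seqs_to[OF assms \<sigma>, symmetric]
      using MCauchy_seqs_to[OF \<sigma>] by blast
  qed
  finally show ?thesis .
qed

text \<open>All pairs of representatives have the same limiting distance, so the choice made by
  \<open>SOME\<close> in \<open>completion_dist\<close> does no harm.\<close>

lemma completion_dist_seqs_to:
  assumes "mcomplete" "l \<in> mtopology closure_of A" "m \<in> mtopology closure_of A"
  shows "completion_dist (A, d) (seqs_to l) (seqs_to m) = d l m"
proof -
  have "(SOME \<sigma>. \<sigma> \<in> seqs_to l) \<in> seqs_to l" "(SOME \<sigma>. \<sigma> \<in> seqs_to m) \<in> seqs_to m"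
    using assms(2,3) seqs_to_nonempty by (simp_all add: some_in_eq)
  from limI[OF tendsto_dist_seqs_to[OF this]] show ?thesis
    using assms by (simp add: completion_dist_def completion_points_eq)
qed

lemma completion_embedding_eq:
  assumes "mcomplete" "a \<in> A"
  shows "completion_embedding (A, d) a = seqs_to a"
  unfolding completion_embedding_def
proof (rule cauchy_rel_seqs_to[OF assms(1)])
  show "(\<lambda>n. a) \<in> seqs_to a"
    using assms(2) subset by (auto simp: seqs_to_def limitin_metric_dist_null)
qed

end

text \<open>The limit \<open>l\<close> may lie outside \<open>A1\<close>, where \<open>f\<close>
  says nothing; the contraction \<open>F\<close> of the ambient spaces extends \<open>f\<close> and
  tells where the new limit is.\<close>

lemma completion_action_seqs_to:
  assumes "Submetric M1 d1 A1" and "Submetric M2 d2 A2" "Metric_space.mcomplete M2 d2"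
    and f: "f ` A1 \<subseteq> A2" and F: "F ` M1 \<subseteq> M2"
    and le: "\<And>a b. \<lbrakk>a \<in> M1; b \<in> M1\<rbrakk> \<Longrightarrow> d2 (F a) (F b) \<le> d1 a b"
    and ext: "\<And>a. a \<in> A1 \<Longrightarrow> f a = F a"
    and l: "l \<in> Metric_space.mtopology M1 d1 closure_of A1"
  shows "cauchy_rel (A2, d2) `` ((\<lambda>\<sigma>. f \<circ> \<sigma>) ` Submetric.seqs_to M1 d1 A1 l)
     = Submetric.seqs_to M2 d2 A2 (F l)"
proof -
  interpret X: Submetric M1 d1 A1 by fact
  interpret Y: Submetric M2 d2 A2 by fact
  have *: "f \<circ> \<sigma> \<in> Y.seqs_to (F l)" if \<sigma>: "\<sigma> \<in> X.seqs_to l" for \<sigma>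
  proof -
    have A1: "\<sigma> n \<in> A1" for n
      using \<sigma> by (auto simp: X.seqs_to_def)
    have l: "l \<in> M1" and lim: "(\<lambda>n. d1 (\<sigma> n) l) \<longlonglongrightarrow> 0"
      using \<sigma> by (auto simp: X.seqs_to_def X.limitin_metric_dist_null)
    have "d2 (f (\<sigma> n)) (F l) \<le> d1 (\<sigma> n) l" for n
      using A1 l le ext X.subset by (metis subset_iff)
    then have "(\<lambda>n. d2 (f (\<sigma> n)) (F l)) \<longlonglongrightarrow> 0"
      by (intro tendsto_sandwich[OF _ _ tendsto_const lim]) auto
    moreover have "range (f \<circ> \<sigma>) \<subseteq> A2" "F l \<in> M2" "\<And>n. f (\<sigma> n) \<in> M2"
      using A1 F f l Y.subset by auto
    ultimately show ?thesis
      by (simp add: Y.seqs_to_def Y.limitin_metric_dist_null)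
  qed
  have "cauchy_rel (A2, d2) `` ((\<lambda>\<sigma>. f \<circ> \<sigma>) ` X.seqs_to l)
      = (\<Union>\<sigma>\<in>X.seqs_to l. cauchy_rel (A2, d2) `` {f \<circ> \<sigma>})"
    by blast
  also have "\<dots> = (\<Union>\<sigma>\<in>X.seqs_to l. Y.seqs_to (F l))"
    by (intro SUP_cong refl Y.cauchy_rel_seqs_to[OF assms(3)] *)
  also have "\<dots> = Y.seqs_to (F l)"
    \<comment> \<open>The union of a constant family is that constant only over a nonempty index
      set, so \<open>l\<close> has to be in the closure.\<close>
    using X.seqs_to_nonempty[OF l] by auto
  finally show ?thesis .
qed

section \<open>Concrete categories and transport of functors\<close>

text \<open>The locale \<open>Metric_space\<close> asks for nonnegativity and symmetry on the whole
  type; \<open>out\<close> provides them off the image of \<open>s\<close>.\<close>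

lemma Metric_space_transport:
  assumes "Metric_space X d" and inj: "inj_on s X"
    and dist: "\<And>x y. \<lbrakk>x \<in> X; y \<in> X\<rbrakk> \<Longrightarrow> d' (s x) (s y) = d x y"
    and out: "\<And>p q. p \<notin> s ` X \<or> q \<notin> s ` X \<Longrightarrow> d' p q = 0"
  shows "Metric_space (s ` X) d'"
proof -
  interpret Metric_space X d by fact
  show ?thesis
  proof
    show "0 \<le> d' p q" for p q
      using out[of p q] dist by (cases "p \<in> s ` X \<and> q \<in> s ` X") auto
    show "d' p q = d' q p" for p q
      using out[of p q] out[of q p] dist commute
      by (cases "p \<in> s ` X \<and> q \<in> s ` X") auto
    show "d' p q = 0 \<longleftrightarrow> p = q" if "p \<in> s ` X" "q \<in> s ` X" for p q
      using that dist inj by (auto simp: inj_on_eq_iff)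
    show "d' p r \<le> d' p q + d' q r" if "p \<in> s ` X" "q \<in> s ` X" "r \<in> s ` X" for p q r
      using that dist triangle by auto
  qed
qed

lemma mcomplete_transport:
  assumes "Metric_space X d" and inj: "inj_on s X"
    and dist: "\<And>x y. \<lbrakk>x \<in> X; y \<in> X\<rbrakk> \<Longrightarrow> d' (s x) (s y) = d x y"
    and out: "\<And>p q. p \<notin> s ` X \<or> q \<notin> s ` X \<Longrightarrow> d' p q = 0"
    and complete: "Metric_space.mcomplete X d"
  shows "Metric_space.mcomplete (s ` X) d'"
proof -
  interpret X: Metric_space X d by fact
  interpret Y: Metric_space "s ` X" d'
    by (rule Metric_space_transport[OF assms(1-4)])
  show ?thesis
    unfolding Y.mcomplete_def
  proof (intro allI impI)
    fix \<tau> assume \<tau>: "Y.MCauchy \<tau>"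
    then have "\<exists>x\<in>X. \<tau> n = s x" for n
      unfolding Y.MCauchy_def by blast
    then obtain \<sigma> where \<sigma>: "\<And>n. \<sigma> n \<in> X" "\<And>n. \<tau> n = s (\<sigma> n)"
      by metis
    have "X.MCauchy \<sigma>"
      using \<tau> \<sigma> unfolding X.MCauchy_def Y.MCauchy_def by (simp add: dist image_subset_iff)
    then obtain x where "limitin X.mtopology \<sigma> x sequentially"
      using complete unfolding X.mcomplete_def by blast
    then have "limitin Y.mtopology \<tau> (s x) sequentially"
      unfolding X.limitin_metric_dist_null Y.limitin_metric_dist_null using \<sigma> by (simp add: dist)
    then show "\<exists>p. limitin Y.mtopology \<tau> p sequentially"
      by auto
  qed
qed

text \<open>The unit laws are equations of functions because the maps are extensional. Associativity
  holds because \<open>f\<close> lands in the set to which the inner composite is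
  restricted.\<close>

lemma category_concrete:
  fixes c :: "'o \<Rightarrow> 'x set"
  assumes "\<And>X Y f. f \<in> H X Y \<Longrightarrow> f \<in> c X \<rightarrow>\<^sub>E c Y"
    and "\<And>X. X \<in> Ob \<Longrightarrow> restrict id (c X) \<in> H X X"
    and "\<And>X Y Z f g. \<lbrakk>f \<in> H X Y; g \<in> H Y Z\<rbrakk> \<Longrightarrow> compose (c X) g f \<in> H X Z"
  shows "category \<lparr> cat_ob = Ob, cat_hom = H, cat_id = (\<lambda>X. restrict id (c X)),
    cat_comp = (\<lambda>X Y Z g f. compose (c X) g f) \<rparr>"
proof -
  have "compose A (compose B h g) f = compose A h (compose A g f)"
    if "f \<in> A \<rightarrow>\<^sub>E B" for A B :: "'x set" and f g h :: "'x \<Rightarrow> 'x"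
    using that by (auto simp: compose_def fun_eq_iff)
  moreover have "compose A f (restrict id A) = f" "compose A (restrict id B) f = f"
    if "f \<in> A \<rightarrow>\<^sub>E B" for A B :: "'x set" and f
    using that by (auto simp: compose_def fun_eq_iff PiE_iff extensional_def)
  ultimately show ?thesis
    unfolding category_def cat.simps using assms by meson
qed

lemma category_Simp: "category Simp"
  unfolding Simp_def
proof (rule category_concrete, goal_cases)
  case (2 K)
  have "restrict id (\<Union>K) ` F = F" if "F \<in> K" for F
    using that by (force simp: image_iff)
  then show ?case
    by auto
next
  case (3 K1 K2 K3 f g)
  have "compose (\<Union>K1) g f ` F = g ` f ` F" if "F \<in> K1" for F
    unfolding image_image using that by (intro image_cong) (auto simp: compose_def)
  with 3 show ?case
    by (auto simp: compose_def PiE_iff)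
qed auto

text \<open>The class of objects is left arbitrary so that \<open>Met1\<close> and
  \<open>CMet1\<close>, which share their morphisms, are both instances.\<close>

lemma category_contracting_maps:
  "category \<lparr> cat_ob = Ob, cat_hom = contracting_maps, cat_id = (\<lambda>X. restrict id (fst X)),
    cat_comp = (\<lambda>X Y Z g f. compose (fst X) g f) \<rparr>"
proof (rule category_concrete, goal_cases)
  case (3 X Y Z f g)
  have "snd Z (g (f a)) (g (f b)) \<le> snd X a b" if "a \<in> fst X" "b \<in> fst X" for a b
  proof -
    have "snd Z (g (f a)) (g (f b)) \<le> snd Y (f a) (f b)"
      using 3 that unfolding contracting_maps_def by blast
    also have "\<dots> \<le> snd X a b"
      using 3 that unfolding contracting_maps_def by blast
    finally show ?thesis .
  qed
  with 3 show ?case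
    by (auto simp: contracting_maps_def compose_def)
qed (auto simp: contracting_maps_def)

lemma category_Met1: "category Met1"
  unfolding Met1_def by (rule category_contracting_maps)

lemma category_CMet1: "category CMet1"
  unfolding CMet1_def Met1_def cat.simps by (rule category_contracting_maps)

lemma is_functor_CMet1:
  assumes "is_functor C Met1 F"
    and "\<And>A. A \<in> cat_ob C \<Longrightarrow> Metric_space.mcomplete (fst (fun_ob F A)) (snd (fun_ob F A))"
  shows "is_functor C CMet1 F"
  using assms category_CMet1 by (simp add: is_functor_def CMet1_def)

lemma contracting_fun_mor:
  assumes "is_functor C CMet1 F" "A \<in> cat_ob C" "B \<in> cat_ob C" "f \<in> cat_hom C A B"
  shows "fun_mor F A B f \<in> contracting_maps (fun_ob F A) (fun_ob F B)"
  using assms by (simp add: is_functor_def CMet1_def Met1_def)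

text \<open>The points \<open>s A x\<close> exhaust the carrier of \<open>fun_ob G A\<close>, so
  each law can be checked there and extensionality does the rest. Metric axioms, completeness and
  functor laws are all inherited from \<open>F\<close> through the isometric bijections
  \<open>s A\<close>.\<close>

lemma is_functor_transport:
  assumes F: "is_functor C CMet1 F"
    and inj: "\<And>A. A \<in> cat_ob C \<Longrightarrow> inj_on (s A) (fst (fun_ob F A))"
    and pts: "\<And>A. A \<in> cat_ob C \<Longrightarrow> fst (fun_ob G A) = s A ` fst (fun_ob F A)"
    and dist: "\<And>A x y. \<lbrakk>A \<in> cat_ob C; x \<in> fst (fun_ob F A); y \<in> fst (fun_ob F A)\<rbrakk> \<Longrightarrow>
      snd (fun_ob G A) (s A x) (s A y) = snd (fun_ob F A) x y"
    and out: "\<And>A p q. \<lbrakk>A \<in> cat_ob C; p \<notin> fst (fun_ob G A) \<or> q \<notin> fst (fun_ob G A)\<rbrakk> \<Longrightarrow>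
      snd (fun_ob G A) p q = 0"
    and ext: "\<And>A B f. \<lbrakk>A \<in> cat_ob C; B \<in> cat_ob C; f \<in> cat_hom C A B\<rbrakk> \<Longrightarrow>
      fun_mor G A B f \<in> extensional (fst (fun_ob G A))"
    and mor: "\<And>A B f x. \<lbrakk>A \<in> cat_ob C; B \<in> cat_ob C; f \<in> cat_hom C A B; x \<in> fst (fun_ob F A)\<rbrakk> \<Longrightarrow>
      fun_mor G A B f (s A x) = s B (fun_mor F A B f x)"
  shows "is_functor C CMet1 G"
proof -
  have C: "category C" and
    obF: "\<And>A. A \<in> cat_ob C \<Longrightarrow> fun_ob F A \<in> cat_ob CMet1" and
    idF: "\<And>A. A \<in> cat_ob C \<Longrightarrow> fun_mor F A A (cat_id C A) = restrict id (fst (fun_ob F A))" and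
    compF: "\<And>X Y Z f g. \<lbrakk>X \<in> cat_ob C; Y \<in> cat_ob C; Z \<in> cat_ob C; f \<in> cat_hom C X Y; g \<in> cat_hom C Y Z\<rbrakk>
      \<Longrightarrow> fun_mor F X Z (cat_comp C X Y Z g f)
        = compose (fst (fun_ob F X)) (fun_mor F Y Z g) (fun_mor F X Y f)"
    using F unfolding is_functor_def by (simp_all add: CMet1_def Met1_def)
  have id: "\<And>A. A \<in> cat_ob C \<Longrightarrow> cat_id C A \<in> cat_hom C A A" and
    comp: "\<And>X Y Z f g. \<lbrakk>X \<in> cat_ob C; Y \<in> cat_ob C; Z \<in> cat_ob C; f \<in> cat_hom C X Y; g \<in> cat_hom C Y Z\<rbrakk>
      \<Longrightarrow> cat_comp C X Y Z g f \<in> cat_hom C X Z"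
    using C unfolding category_def by blast+
  have memF: "fun_mor F A B f x \<in> fst (fun_ob F B)"
    if "A \<in> cat_ob C" "B \<in> cat_ob C" "f \<in> cat_hom C A B" "x \<in> fst (fun_ob F A)" for A B f x
    using contracting_fun_mor[OF F that(1-3)] that(4) by (auto simp: contracting_maps_def)
  have ob: "fun_ob G A \<in> cat_ob CMet1" if A: "A \<in> cat_ob C" for A
  proof -
    have FA: "Metric_space (fst (fun_ob F A)) (snd (fun_ob F A))"
        "Metric_space.mcomplete (fst (fun_ob F A)) (snd (fun_ob F A))"
        "\<forall>a\<in>fst (fun_ob F A). \<forall>b\<in>fst (fun_ob F A). snd (fun_ob F A) a b \<le> 1"
      using obF[OF A] by (auto simp: CMet1_def Met1_def)
    have *: "p \<notin> s A ` fst (fun_ob F A) \<or> q \<notin> s A ` fst (fun_ob F A) \<Longrightarrow> snd (fun_ob G A) p q = 0" for p q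
      using out[OF A] pts[OF A] by auto
    show ?thesis
      using Metric_space_transport[OF FA(1) inj[OF A] dist[OF A] *]
        mcomplete_transport[OF FA(1) inj[OF A] dist[OF A] * FA(2)] FA(3) pts[OF A] dist[OF A]
      by (simp add: CMet1_def Met1_def)
  qed
  have hom: "fun_mor G A B f \<in> contracting_maps (fun_ob G A) (fun_ob G B)"
    if AB: "A \<in> cat_ob C" "B \<in> cat_ob C" "f \<in> cat_hom C A B" for A B f
    using contracting_fun_mor[OF F AB] ext[OF AB]
    by (auto simp: contracting_maps_def PiE_def pts AB mor memF dist)
  have idG: "fun_mor G A A (cat_id C A) = restrict id (fst (fun_ob G A))" if A: "A \<in> cat_ob C" for A
  proof (rule extensionalityI[OF ext[OF A A id[OF A]]])
    show "fun_mor G A A (cat_id C A) p = restrict id (fst (fun_ob G A)) p" if "p \<in> fst (fun_ob G A)" for p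
      using that A id[OF A] by (auto simp: pts mor idF)
  qed simp
  have compG: "fun_mor G X Z (cat_comp C X Y Z g f)
        = compose (fst (fun_ob G X)) (fun_mor G Y Z g) (fun_mor G X Y f)"
    if XYZ: "X \<in> cat_ob C" "Y \<in> cat_ob C" "Z \<in> cat_ob C" "f \<in> cat_hom C X Y" "g \<in> cat_hom C Y Z" for X Y Z f g
  proof (rule extensionalityI[OF ext[OF XYZ(1,3) comp[OF XYZ]]])
    show "fun_mor G X Z (cat_comp C X Y Z g f) p
        = compose (fst (fun_ob G X)) (fun_mor G Y Z g) (fun_mor G X Y f) p" if "p \<in> fst (fun_ob G X)" for p
      using that XYZ comp[OF XYZ] by (auto simp: pts mor compF compose_def memF)
  qed simp
  show ?thesis
    unfolding is_functor_def using C category_CMet1 ob hom idG compG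
    by (simp add: CMet1_def Met1_def)
qed

text \<open>The isometry points from \<open>G\<close> to \<open>F\<close>, so its components are the
  inverses of \<open>s\<close>. As \<open>s\<close> preserves distances, both directions are
  contracting.\<close>

lemma natural_isometry_transport:
  assumes F: "is_functor C CMet1 F"
    and inj: "\<And>A. A \<in> cat_ob C \<Longrightarrow> inj_on (s A) (fst (fun_ob F A))"
    and pts: "\<And>A. A \<in> cat_ob C \<Longrightarrow> fst (fun_ob G A) = s A ` fst (fun_ob F A)"
    and dist: "\<And>A x y. \<lbrakk>A \<in> cat_ob C; x \<in> fst (fun_ob F A); y \<in> fst (fun_ob F A)\<rbrakk> \<Longrightarrow>
      snd (fun_ob G A) (s A x) (s A y) = snd (fun_ob F A) x y"
    and mor: "\<And>A B f x. \<lbrakk>A \<in> cat_ob C; B \<in> cat_ob C; f \<in> cat_hom C A B; x \<in> fst (fun_ob F A)\<rbrakk> \<Longrightarrow>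
      fun_mor G A B f (s A x) = s B (fun_mor F A B f x)"
  shows "natural_isometry C G F
    (\<lambda>A. restrict (the_inv_into (fst (fun_ob F A)) (s A)) (fst (fun_ob G A)))"
  unfolding natural_isometry_def
proof (intro conjI ballI)
  fix A assume A: "A \<in> cat_ob C"
  have inv: "the_inv_into (fst (fun_ob F A)) (s A) (s A x) = x" if "x \<in> fst (fun_ob F A)" for x
    using the_inv_into_f_f[OF inj[OF A] that] .
  show "restrict (the_inv_into (fst (fun_ob F A)) (s A)) (fst (fun_ob G A))
      \<in> contracting_maps (fun_ob G A) (fun_ob F A)"
    by (auto simp: contracting_maps_def pts[OF A] inv dist[OF A])
  show "\<exists>\<eta>\<in>contracting_maps (fun_ob F A) (fun_ob G A).
      compose (fst (fun_ob G A)) \<eta> (restrict (the_inv_into (fst (fun_ob F A)) (s A)) (fst (fun_ob G A)))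
        = restrict id (fst (fun_ob G A)) \<and>
      compose (fst (fun_ob F A)) (restrict (the_inv_into (fst (fun_ob F A)) (s A)) (fst (fun_ob G A))) \<eta>
        = restrict id (fst (fun_ob F A))"
  proof (intro bexI conjI)
    show "restrict (s A) (fst (fun_ob F A)) \<in> contracting_maps (fun_ob F A) (fun_ob G A)"
      by (auto simp: contracting_maps_def pts[OF A] dist[OF A])
  qed (auto simp: compose_def pts[OF A] inv fun_eq_iff)
next
  fix A B f assume AB: "A \<in> cat_ob C" "B \<in> cat_ob C" "f \<in> cat_hom C A B"
  have mem: "fun_mor F A B f x \<in> fst (fun_ob F B)" if "x \<in> fst (fun_ob F A)" for x
    using contracting_fun_mor[OF F AB] that by (auto simp: contracting_maps_def)
  show "compose (fst (fun_ob G A)) (restrict (the_inv_into (fst (fun_ob F B)) (s B)) (fst (fun_ob G B)))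
        (fun_mor G A B f) =
      compose (fst (fun_ob G A)) (fun_mor F A B f)
        (restrict (the_inv_into (fst (fun_ob F A)) (s A)) (fst (fun_ob G A)))"
    (is "?l = ?r")
  proof (rule extensionalityI)
    fix p assume "p \<in> fst (fun_ob G A)"
    then obtain x where x: "x \<in> fst (fun_ob F A)" "p = s A x"
      using pts[OF AB(1)] by blast
    then show "?l p = ?r p"
      by (simp add: compose_def pts AB mor mem the_inv_into_f_f[OF inj])
  qed simp_all
qed

section \<open>Measurable maps into discrete spaces\<close>

text \<open>Two different points of one set \<open>V n\<close> never differ by a rational. So
  rational translates of a compact subset are disjoint, infinitely many of them fit into a bounded
  interval, and the measure must be zero. A countable cover is asked for because its preimages will
  cut a non-null set into countably many pieces.\<close>

lemma countable_cover_Vitali: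
  "\<exists>V :: nat \<Rightarrow> real set. (\<Union>n. V n) = UNIV \<and>
     (\<forall>n C. compact C \<and> C \<subseteq> V n \<longrightarrow> emeasure lborel C = 0)"
proof -
  \<comment> \<open>\<open>rep\<close> selects one point from each coset of the rationals.\<close>
  define rep :: "real \<Rightarrow> real" where "rep x = (SOME y. x - y \<in> \<rat>)" for x
  have rep: "x - rep x \<in> \<rat>" for x
    unfolding rep_def by (rule someI[of _ x]) simp
  have rep_eq: "rep x = rep y" if "x - y \<in> \<rat>" for x y
  proof -
    have "x - z \<in> \<rat> \<longleftrightarrow> y - z \<in> \<rat>" for z
      using Rats_diff[OF _ that, of "x - z"] Rats_add[OF _ that, of "y - z"] by auto
    then show ?thesis
      by (simp add: rep_def)
  qed
  \<comment> \<open>\<open>V n\<close> is the selector set \<open>range rep\<close> translated by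
    the n-th rational.\<close>
  define V where "V n = {x. x - rep x = from_nat_into \<rat> n}" for n
  have "x \<in> (\<Union>n. V n)" for x
  proof -
    obtain n where "from_nat_into \<rat> n = x - rep x"
      using from_nat_into_surj[OF countable_rat rep[of x]] by blast
    then have "x \<in> V n"
      by (simp add: V_def)
    then show ?thesis
      by blast
  qed
  then have "(\<Union>n. V n) = UNIV"
    by blast
  moreover have "emeasure lborel C = 0" if C: "compact C" "C \<subseteq> V n" for n C
  proof -
    \<comment> \<open>\<open>T k\<close> is \<open>C\<close> moved to the right by
      \<open>1 / (k + 1)\<close>. These shifts are rational and at most 1, which keeps all
      translates inside \<open>{-b..b + 1}\<close> below.\<close>
    define T where "T k = (+) (- inverse (real (Suc k))) -` C" for k
    have C_sets: "C \<in> sets borel"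
      using C(1) by (rule borel_compact)
    have T_sets: "T k \<in> sets borel" for k
      using measurable_sets[of "(+) (- inverse (real (Suc k)))" borel borel C] C_sets
      by (simp add: T_def)
    have T_eq: "emeasure lborel (T k) = emeasure lborel C" for k
    proof -
      have "emeasure lborel C = emeasure (distr lborel borel ((+) (- inverse (real (Suc k))))) C"
        by (simp only: lborel_distr_plus)
      also have "\<dots> = emeasure lborel (T k)"
        using C_sets unfolding T_def by (subst emeasure_distr) simp_all
      finally show ?thesis ..
    qed
    have disj: "disjoint_family T"
      unfolding disjoint_family_on_def
    proof (intro ballI impI, rule ccontr)
      fix k l :: nat assume "k \<noteq> l" "T k \<inter> T l \<noteq> {}"
      then obtain x where "x \<in> T k" "x \<in> T l"
        by blast
      define y z where "y = - inverse (real (Suc k)) + x" and "z = - inverse (real (Suc l)) + x"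
      have "y \<in> V n" "z \<in> V n"
        using \<open>x \<in> T k\<close> \<open>x \<in> T l\<close> C(2) by (auto simp: T_def y_def z_def)
      moreover have "y - z = inverse (real (Suc l)) - inverse (real (Suc k))"
        by (simp add: y_def z_def)
      moreover have "inverse (real (Suc l)) - inverse (real (Suc k)) \<in> \<rat>"
        by (intro Rats_diff Rats_inverse Rats_of_nat)
      ultimately have "y = z"
        using rep_eq[of y z] by (simp add: V_def)
      with \<open>k \<noteq> l\<close> show False
        by (simp add: y_def z_def)
    qed
    obtain b where b: "\<And>x. x \<in> C \<Longrightarrow> \<bar>x\<bar> \<le> b" and "b > 0"
      using compact_imp_bounded[OF C(1)] unfolding bounded_pos by auto
    have T_sub: "T k \<subseteq> {-b..b + 1}" for k
    proof
      fix x assume "x \<in> T k"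
      then have "\<bar>- inverse (real (Suc k)) + x\<bar> \<le> b"
        using b by (simp add: T_def)
      moreover have "0 \<le> inverse (real (Suc k))" "inverse (real (Suc k)) \<le> 1"
        by (simp_all add: field_simps)
      ultimately show "x \<in> {-b..b + 1}"
        unfolding atLeastAtMost_iff by linarith
    qed
    have fin: "emeasure lborel C = ennreal (measure lborel C)"
      using emeasure_compact_finite[OF C(1)] by (simp add: emeasure_eq_ennreal_measure less_top)
    have bound: "real N * measure lborel C \<le> 2 * b + 1" for N
    proof -
      have "ennreal (real N * measure lborel C) = (\<Sum>k<N. emeasure lborel (T k))"
        by (simp add: T_eq fin ennreal_mult ennreal_of_nat_eq_real_of_nat)
      also have "\<dots> = emeasure lborel (\<Union>k<N. T k)"
        using T_sets disj by (intro sum_emeasure) (auto simp: disjoint_family_on_def)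
      also have "\<dots> \<le> emeasure lborel {-b..b + 1}"
        using T_sub by (intro emeasure_mono) auto
      also have "\<dots> = ennreal (2 * b + 1)"
        using \<open>b > 0\<close> by (subst emeasure_lborel_Icc) auto
      finally show ?thesis
        using \<open>b > 0\<close> by (subst (asm) ennreal_le_iff) auto
    qed
    have "measure lborel C = 0"
    proof (rule ccontr)
      assume "measure lborel C \<noteq> 0"
      then have "0 < measure lborel C"
        by (simp add: less_le)
      from reals_Archimedean3[OF this] obtain N where "2 * b + 1 < real N * measure lborel C"
        by blast
      with bound[of N] show False
        by linarith
    qed
    then show ?thesis
      by (simp add: fin)
  qed
  ultimately show ?thesis
    by blast
qed

section \<open>Closed and compact inner regularity of finite measures\<close>

text \<open>The error budget of countable choices: tolerance \<open>e / 2^(i+1)\<close> at index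
  \<open>i\<close> adds up to \<open>e\<close>. With \<open>e = (1/2) ^ k\<close> it is also the
  tail bound in the Borel-Cantelli argument.\<close>

lemma (in finite_measure) measure_UN_le_geometric:
  assumes "\<And>i. D i \<in> sets M" "\<And>i. measure M (D i) \<le> e * (1/2) ^ Suc i"
  shows "measure M (\<Union>i. D i) \<le> e"
proof -
  have sums: "(\<lambda>i. e * (1/2) ^ Suc i) sums (e * 1)"
    by (intro sums_mult power_half_series)
  have summable: "summable (\<lambda>i. measure M (D i))"
    using assms(2) by (intro summable_comparison_test'[OF sums_summable[OF sums], of 0]) simp
  have "measure M (\<Union>i. D i) \<le> (\<Sum>i. measure M (D i))"
    using assms(1) by (intro finite_measure_subadditive_countably summable) auto
  also have "\<dots> \<le> (\<Sum>i. e * (1/2) ^ Suc i)"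
    by (intro suminf_le assms(2) summable sums_summable[OF sums])
  also have "\<dots> = e"
    using sums_unique[OF sums] by simp
  finally show ?thesis .
qed

lemma closedin_in_sets:
  assumes "closedin T F" "\<And>U. openin T U \<Longrightarrow> U \<in> sets M"
  shows "F \<in> sets M"
proof -
  have "F = topspace T - (topspace T - F)"
    using closedin_subset[OF assms(1)] by auto
  then show ?thesis
    using assms by (metis openin_topspace closedin_def sets.Diff)
qed

text \<open>The induction over the generated sigma-algebra has to survive complements, so a set and
  its complement are treated together. The base case is that an open set of a metrizable space is an
  increasing union of closed sets.\<close>

lemma (in finite_measure) closed_inner_regular:
  assumes T: "metrizable_space T" and open_sets: "\<And>U. openin T U \<Longrightarrow> U \<in> sets M"
    and B: "B \<in> sigma_sets (topspace T) {U. openin T U}" and "e > 0"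
  shows "\<exists>F. closedin T F \<and> F \<subseteq> B \<and> measure M (B - F) < e"
proof -
  have closed_sets: "F \<in> sets M" if "closedin T F" for F
    using that open_sets by (rule closedin_in_sets)
  have sigma_sub: "A \<in> sets M" if "A \<in> sigma_sets (topspace T) {U. openin T U}" for A
    using that open_sets sets.sigma_sets_subset'[of "{U. openin T U}" M "topspace T"] by auto
  \<comment> \<open>An infinite union of closed sets may fail to be closed, so it is cut off at a
    finite stage. The pieces cost at most \<open>e / 2\<close> in total, and continuity from above
    finds a stage whose loss is still below \<open>e\<close>.\<close>
  have union: "\<exists>F. closedin T F \<and> F \<subseteq> (\<Union>i. A i) \<and> measure M ((\<Union>i. A i) - F) < e"
    if F: "\<And>i. closedin T (F i)" "\<And>i. F i \<subseteq> A i"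
      and A: "\<And>i. A i \<in> sets M"
      and le: "\<And>i. measure M (A i - F i) \<le> e / 2 * (1/2) ^ Suc i" and "e > 0"
    for A F :: "nat \<Rightarrow> 'a set" and e
  proof -
    define H where "H n = (\<Union>i\<le>n. F i)" for n
    have H: "closedin T (H n)" for n
      unfolding H_def by (rule closedin_Union) (use F in auto)
    have "(\<lambda>n. measure M ((\<Union>i. A i) - H n)) \<longlonglongrightarrow> measure M (\<Inter>n. (\<Union>i. A i) - H n)"
      using A closed_sets[OF H] by (intro finite_Lim_measure_decseq) (auto simp: decseq_def H_def)
    moreover have "measure M (\<Inter>n. (\<Union>i. A i) - H n) < e"
    proof -
      have "measure M (\<Inter>n. (\<Union>i. A i) - H n) \<le> measure M (\<Union>i. A i - F i)"
        using A closed_sets[OF F(1)] by (intro finite_measure_mono) (fastforce simp: H_def)+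
      also have "\<dots> \<le> e / 2"
        using A closed_sets[OF F(1)] by (intro measure_UN_le_geometric le) auto
      finally show ?thesis
        using \<open>e > 0\<close> by simp
    qed
    ultimately have "\<forall>\<^sub>F n in sequentially. measure M ((\<Union>i. A i) - H n) < e"
      by (rule order_tendstoD)
    then obtain n where "measure M ((\<Union>i. A i) - H n) < e"
      by (auto simp: eventually_sequentially)
    moreover have "H n \<subseteq> (\<Union>i. A i)"
      using F(2) by (auto simp: H_def)
    ultimately show ?thesis
      using H by blast
  qed
  have "\<forall>e>0. (\<exists>F. closedin T F \<and> F \<subseteq> B \<and> measure M (B - F) < e) \<and>
    (\<exists>F. closedin T F \<and> F \<subseteq> topspace T - B \<and> measure M (topspace T - B - F) < e)"
    using B
  proof induction
    case (Basic U)
    then have U: "openin T U"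
      by simp
    show ?case
    proof (intro allI impI conjI)
      fix e :: real assume "e > 0"
      from open_imp_fsigma_in[OF T U] obtain C where
        C: "\<And>n::nat. closedin T (C n)" "\<Union> (range C) = U"
        unfolding fsigma_in_ascending by blast
      have "measure M (C i - C i) \<le> e / 2 * (1/2) ^ Suc i" for i
        using \<open>e > 0\<close> by simp
      from union[of C C, OF C(1) _ closed_sets[OF C(1)] this \<open>e > 0\<close>]
      show "\<exists>F. closedin T F \<and> F \<subseteq> U \<and> measure M (U - F) < e"
        using C(2) by simp
      show "\<exists>F. closedin T F \<and> F \<subseteq> topspace T - U \<and> measure M (topspace T - U - F) < e"
        using U \<open>e > 0\<close> by (intro exI[of _ "topspace T - U"]) auto
    qed
  next
    case Empty
    show ?case
      by (intro allI impI conjI exI[of _ "{}"] exI[of _ "topspace T"]) auto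
  next
    case (Compl A)
    then have "topspace T - (topspace T - A) = A"
      using sigma_sets_into_sp[OF _ Compl.hyps] openin_subset by blast
    with Compl.IH show ?case
      by simp
  next
    case (Union A)
    show ?case
    proof (intro allI impI conjI)
      fix e :: real assume "e > 0"
      then have pos: "e / 2 * (1/2) ^ Suc i > 0" for i
        by simp
      have "\<exists>F. closedin T F \<and> F \<subseteq> A i \<and> measure M (A i - F) < e / 2 * (1/2) ^ Suc i" for i
        using Union.IH[of i] pos[of i] by blast
      then obtain F where F: "\<And>i. closedin T (F i)" "\<And>i. F i \<subseteq> A i"
          "\<And>i. measure M (A i - F i) < e / 2 * (1/2) ^ Suc i"
        by metis
      have "\<exists>G. closedin T G \<and> G \<subseteq> topspace T - A i \<and>
          measure M (topspace T - A i - G) < e / 2 * (1/2) ^ Suc i" for i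
        using Union.IH[of i] pos[of i] by blast
      then obtain G where G: "\<And>i. closedin T (G i)" "\<And>i. G i \<subseteq> topspace T - A i"
          "\<And>i. measure M (topspace T - A i - G i) < e / 2 * (1/2) ^ Suc i"
        by metis
      have A: "A i \<in> sets M" for i
        by (rule sigma_sub[OF Union.hyps])
      show "\<exists>F. closedin T F \<and> F \<subseteq> (\<Union>i. A i) \<and> measure M ((\<Union>i. A i) - F) < e"
        using union[of F A, OF F(1,2) A less_imp_le[OF F(3)] \<open>e > 0\<close>] .
      \<comment> \<open>For the complement the approximants are intersected, which keeps them
        closed; no cut-off is involved.\<close>
      have "measure M (topspace T - (\<Union>i. A i) - (\<Inter>i. G i)) \<le> measure M (\<Union>i. topspace T - A i - G i)"
        using A closed_sets[OF G(1)] open_sets[OF openin_topspace]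
        by (intro finite_measure_mono) auto
      also have "\<dots> \<le> e / 2"
        using A closed_sets[OF G(1)] open_sets[OF openin_topspace]
        by (intro measure_UN_le_geometric less_imp_le[OF G(3)]) auto
      finally have "measure M (topspace T - (\<Union>i. A i) - (\<Inter>i. G i)) < e"
        using \<open>e > 0\<close> by simp
      moreover have "closedin T (\<Inter>i. G i)"
        using G(1) by (intro closedin_Inter) auto
      ultimately show "\<exists>F. closedin T F \<and> F \<subseteq> topspace T - (\<Union>i. A i) \<and>
          measure M (topspace T - (\<Union>i. A i) - F) < e"
        using G(2) by (intro exI[of _ "\<Inter>i. G i"]) blast
    qed
  qed
  with \<open>e > 0\<close> show ?thesis
    by blast
qed

text \<open>Ulam's argument: at each scale, finitely many small closed balls around a dense sequence
  cover all but a small part. The points covered at every scale form a closed totally bounded set,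
  which completeness makes compact.\<close>

lemma (in finite_measure) tight_completely_metrizable:
  assumes T: "completely_metrizable_space T" "second_countable T"
    and open_sets: "\<And>U. openin T U \<Longrightarrow> U \<in> sets M" and "e > 0"
  shows "\<exists>K. compactin T K \<and> measure M (topspace T - K) < e"
proof (cases "topspace T = {}")
  case True
  then show ?thesis
    using \<open>e > 0\<close> by (intro exI[of _ "{}"]) simp
next
  case False
  from T(1) obtain X d where "Metric_space X d" and complete: "Metric_space.mcomplete X d"
    and T_eq: "T = Metric_space.mtopology X d"
    unfolding completely_metrizable_space_def by blast
  interpret Metric_space X d by fact
  have top: "topspace T = X"
    by (simp add: T_eq)
  have closed_sets: "F \<in> sets M" if "closedin T F" for F
    using that open_sets by (rule closedin_in_sets)
  obtain D where D: "countable D" "D \<subseteq> X" "mtopology closure_of D = X"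
    using second_countable_imp_separable_space[OF T(2)] unfolding separable_space_def T_eq by auto
  have "D \<noteq> {}"
    using False D(3) top by auto
  define a where "a = from_nat_into D"
  have range_a: "range a = D"
    using \<open>D \<noteq> {}\<close> D(1) by (simp add: a_def range_from_nat_into)
  define r where "r k = inverse (real (Suc k))" for k
  define E where "E k n = (\<Union>i\<le>n. mcball (a i) (r k))" for k n
  have E_closed: "closedin T (E k n)" for k n
    unfolding E_def T_eq by (rule closedin_Union) auto
  have cover: "\<exists>n. x \<in> E k n" if "x \<in> X" for x k
  proof -
    have "0 < r k"
      by (simp add: r_def)
    with that D(3) obtain y where "y \<in> D" "y \<in> mball x (r k)"
      unfolding metric_closure_of by blast
    moreover then obtain i where "y = a i"
      using range_a by blast
    ultimately have "x \<in> mcball (a i) (r k)"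
      by (simp add: commute less_imp_le)
    then show ?thesis
      by (auto simp: E_def)
  qed
  have "\<exists>n. measure M (X - E k n) < e / 2 * (1/2) ^ Suc k" for k
  proof -
    have "(\<lambda>n. measure M (X - E k n)) \<longlonglongrightarrow> measure M (\<Inter>n. X - E k n)"
      using closed_sets[OF E_closed] open_sets[OF openin_topspace] top
      by (intro finite_Lim_measure_decseq) (auto simp: decseq_def E_def)
    moreover have "(\<Inter>n. X - E k n) = {}"
      using cover by blast
    moreover have "0 < e / 2 * (1/2) ^ Suc k"
      using \<open>e > 0\<close> by simp
    ultimately have "\<forall>\<^sub>F n in sequentially. measure M (X - E k n) < e / 2 * (1/2) ^ Suc k"
      by (intro order_tendstoD(2)[of _ 0]) (simp_all only: measure_empty)
    then show ?thesis
      by (auto simp: eventually_sequentially)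
  qed
  then obtain N where N: "\<And>k. measure M (X - E k (N k)) < e / 2 * (1/2) ^ Suc k"
    by metis
  define K where "K = (\<Inter>k. E k (N k))"
  have K_closed: "closedin T K"
    unfolding K_def using E_closed by (intro closedin_Inter) auto
  have "mtotally_bounded K"
    unfolding mtotally_bounded_def
  proof (intro allI impI)
    fix \<epsilon> :: real assume "\<epsilon> > 0"
    \<comment> \<open>The centres \<open>a i\<close> may lie outside \<open>K\<close>, while the net
      has to be taken in \<open>K\<close>. Passing from \<open>a i\<close> to a point
      \<open>c i\<close> of \<open>K\<close> doubles the radius, hence
      \<open>\<epsilon> / 2\<close>.\<close>
    then obtain k where k: "r k < \<epsilon> / 2"
      unfolding r_def using reals_Archimedean[of "\<epsilon> / 2"] by auto
    define I where "I = {i. i \<le> N k \<and> K \<inter> mcball (a i) (r k) \<noteq> {}}"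
    have "\<forall>i\<in>I. \<exists>c. c \<in> K \<inter> mcball (a i) (r k)"
      by (auto simp: I_def)
    then obtain c where c: "\<And>i. i \<in> I \<Longrightarrow> c i \<in> K \<and> c i \<in> mcball (a i) (r k)"
      by (metis IntE)
    have "K \<subseteq> (\<Union>x\<in>c ` I. mball x \<epsilon>)"
    proof
      fix x assume "x \<in> K"
      then have "x \<in> E k (N k)"
        by (auto simp: K_def)
      then obtain i where i: "i \<le> N k" "x \<in> mcball (a i) (r k)"
        by (auto simp: E_def)
      then have "i \<in> I"
        using \<open>x \<in> K\<close> by (auto simp: I_def)
      with c have ci: "c i \<in> mcball (a i) (r k)"
        by blast
      have "d (c i) x \<le> d (c i) (a i) + d (a i) x"
        using ci i(2) by (intro triangle) auto
      also have "\<dots> < \<epsilon>"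
        using ci i(2) k commute[of "c i" "a i"] by simp
      finally have "x \<in> mball (c i) \<epsilon>"
        using ci i(2) by simp
      then show "x \<in> (\<Union>x\<in>c ` I. mball x \<epsilon>)"
        using \<open>i \<in> I\<close> by blast
    qed
    moreover have "finite (c ` I)" "c ` I \<subseteq> K"
      using c by (auto simp: I_def)
    ultimately show "\<exists>L. finite L \<and> L \<subseteq> K \<and> K \<subseteq> (\<Union>x\<in>L. mball x \<epsilon>)"
      by blast
  qed
  then have "compactin T (T closure_of K)"
    using mtotally_bounded_eq_compact_closure_of[OF complete] by (simp add: T_eq)
  then have "compactin T K"
    by (simp add: closure_of_closedin[OF K_closed])
  moreover have "measure M (topspace T - K) \<le> measure M (\<Union>k. X - E k (N k))"
    using closed_sets[OF E_closed] open_sets[OF openin_topspace]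
    unfolding top by (intro finite_measure_mono) (auto simp: K_def)
  moreover have "measure M (\<Union>k. X - E k (N k)) \<le> e / 2"
    using closed_sets[OF E_closed] open_sets[OF openin_topspace]
    unfolding top by (intro measure_UN_le_geometric less_imp_le[OF N]) auto
  ultimately show ?thesis
    using \<open>e > 0\<close> by (intro exI[of _ K]) simp
qed

text \<open>Lusin's argument: \<open>h\<close> is continuous on a compact set on which every preimage of a basic open
  set is relatively clopen.\<close>

lemma (in finite_measure) compact_image_inner_regular:
  fixes h :: "'a \<Rightarrow> real"
  assumes T: "completely_metrizable_space T" "second_countable T"
    and open_sets: "\<And>U. openin T U \<Longrightarrow> U \<in> sets M"
    and inner: "\<And>A e. \<lbrakk>A \<in> sets M; A \<subseteq> topspace T; e > 0\<rbrakk> \<Longrightarrow>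
      \<exists>F. closedin T F \<and> F \<subseteq> A \<and> measure M (A - F) < e"
    and h[measurable]: "h \<in> borel_measurable M"
    and B: "B \<in> sets M" "B \<subseteq> topspace T" and "e > 0"
  shows "\<exists>K. compactin T K \<and> K \<subseteq> B \<and> compact (h ` K) \<and> measure M (B - K) < e"
proof -
  have top: "topspace T \<in> sets M"
    by (rule open_sets[OF openin_topspace])
  have closed_sets: "F \<in> sets M" if "closedin T F" for F
    using that open_sets by (rule closedin_in_sets)
  have "\<exists>U :: nat \<Rightarrow> real set. (\<forall>n. open (U n)) \<and> (\<forall>W. open W \<longrightarrow> (\<exists>I. W = \<Union> {U n |n. n \<in> I}))"
    by (rule univ_second_countable_sequence) blast
  then obtain U :: "nat \<Rightarrow> real set" where U: "\<And>n. open (U n)"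
      "\<And>W. open W \<Longrightarrow> \<exists>I. W = \<Union> {U n |n. n \<in> I}"
    by blast
  define Q where "Q n = h -` U n \<inter> topspace T" for n
  have Q: "Q n \<in> sets M" for n
  proof -
    have "Q n = (h -` U n \<inter> space M) \<inter> topspace T"
      using sets.sets_into_space[OF top] unfolding Q_def by blast
    then show ?thesis
      using U(1) h top by (metis borel_open measurable_sets sets.Int)
  qed
  \<comment> \<open>These tolerances sum to \<open>e / 8\<close> for the sets inside
    \<open>Q n\<close> and again for those in the complements. With \<open>e / 4\<close> each for
    \<open>K0\<close> and \<open>FB\<close>, the total loss is at most
    \<open>3 * e / 4\<close>.\<close>
  have pos: "e / 8 * (1/2) ^ Suc n > 0" for n
    using \<open>e > 0\<close> by simp
  have "\<exists>F. closedin T F \<and> F \<subseteq> Q n \<and> measure M (Q n - F) < e / 8 * (1/2) ^ Suc n" for n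
    by (rule inner[OF Q _ pos]) (auto simp: Q_def)
  then obtain F where F: "\<And>n. closedin T (F n)" "\<And>n. F n \<subseteq> Q n"
      "\<And>n. measure M (Q n - F n) < e / 8 * (1/2) ^ Suc n"
    by metis
  have "\<exists>F. closedin T F \<and> F \<subseteq> topspace T - Q n \<and>
      measure M (topspace T - Q n - F) < e / 8 * (1/2) ^ Suc n" for n
    using Q top by (intro inner pos) auto
  then obtain G where G: "\<And>n. closedin T (G n)" "\<And>n. G n \<subseteq> topspace T - Q n"
      "\<And>n. measure M (topspace T - Q n - G n) < e / 8 * (1/2) ^ Suc n"
    by metis
  obtain K0 where K0: "compactin T K0" "measure M (topspace T - K0) < e / 4"
    using tight_completely_metrizable[OF T open_sets, of "e / 4"] \<open>e > 0\<close> by auto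
  have "Hausdorff_space T"
    using T(1) completely_metrizable_imp_metrizable_space metrizable_imp_Hausdorff_space by blast
  then have K0_closed: "closedin T K0"
    using K0(1) compactin_imp_closedin by blast
  obtain FB where FB: "closedin T FB" "FB \<subseteq> B" "measure M (B - FB) < e / 4"
    using inner[OF B, of "e / 4"] \<open>e > 0\<close> by auto
  define L where "L = (\<Inter>n. F n \<union> G n)"
  define K where "K = K0 \<inter> (FB \<inter> L)"
  have L_closed: "closedin T L"
    unfolding L_def using F(1) G(1) by (intro closedin_Inter) auto
  have K_compact: "compactin T K"
    unfolding K_def using K0(1) FB(1) L_closed by (intro compact_Int_closedin closedin_Int)
  have K_sub: "K \<subseteq> topspace T" "K \<subseteq> B"
    using compactin_subset_topspace[OF K_compact] FB(2) by (auto simp: K_def)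
  have U_cont: "openin (subtopology T K) {x \<in> K. h x \<in> U n}" for n
  proof -
    \<comment> \<open>Every point of \<open>K\<close> is in \<open>F n\<close> or in
      \<open>G n\<close>, so on \<open>K\<close> belonging to \<open>Q n\<close> means avoiding the
      closed set \<open>G n\<close>.\<close>
    have "{x \<in> K. h x \<in> U n} = (topspace T - G n) \<inter> K"
      using F(2) G(2) K_sub(1) by (fastforce simp: K_def L_def Q_def)
    moreover have "openin T (topspace T - G n)"
      using G(1) by blast
    ultimately show ?thesis
      by (auto simp: openin_subtopology)
  qed
  have "continuous_map (subtopology T K) euclidean h"
    unfolding continuous_map_def
  proof (intro conjI allI impI)
    fix W :: "real set" assume "openin euclidean W"
    then obtain I where "W = \<Union> {U n |n. n \<in> I}"
      using U(2)[of W] by auto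
    then have "{x \<in> K. h x \<in> W} = (\<Union>n\<in>I. {x \<in> K. h x \<in> U n})"
      by auto
    also have "openin (subtopology T K) \<dots>"
      by (rule openin_Union) (use U_cont in auto)
    finally show "openin (subtopology T K) {x \<in> topspace (subtopology T K). h x \<in> W}"
      using K_sub(1) by (simp add: topspace_subtopology Int_absorb1)
  qed auto
  moreover have "compactin (subtopology T K) K"
    using K_compact by (simp add: compactin_subtopology)
  ultimately have "compactin euclidean (h ` K)"
    using image_compactin by blast
  then have "compact (h ` K)"
    by simp
  moreover have "measure M (B - K) < e"
  proof -
    have "topspace T - L \<subseteq> (\<Union>n. Q n - F n) \<union> (\<Union>n. topspace T - Q n - G n)"
      by (auto simp: L_def)
    then have "B - K \<subseteq> (topspace T - K0) \<union> (B - FB) \<union> ((\<Union>n. Q n - F n) \<union> (\<Union>n. topspace T - Q n - G n))"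
      using B(2) unfolding K_def by blast
    then have "measure M (B - K) \<le> measure M ((topspace T - K0) \<union> (B - FB)
        \<union> ((\<Union>n. Q n - F n) \<union> (\<Union>n. topspace T - Q n - G n)))"
      using B(1) Q top closed_sets K0_closed FB(1) F(1) G(1) by (intro finite_measure_mono) auto
    also have "\<dots> \<le> (measure M (topspace T - K0) + measure M (B - FB))
        + (measure M (\<Union>n. Q n - F n) + measure M (\<Union>n. topspace T - Q n - G n))"
      using B(1) Q top closed_sets K0_closed FB(1) F(1) G(1)
      by (intro order_trans[OF measure_Un_le] add_mono measure_Un_le order_refl) auto
    also have "measure M (\<Union>n. Q n - F n) \<le> e / 8"
      using Q closed_sets[OF F(1)] by (intro measure_UN_le_geometric less_imp_le[OF F(3)]) auto
    also have "measure M (\<Union>n. topspace T - Q n - G n) \<le> e / 8"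
      using Q top closed_sets[OF G(1)] by (intro measure_UN_le_geometric less_imp_le[OF G(3)]) auto
    finally show ?thesis
      using K0(2) FB(3) \<open>e > 0\<close> by linarith
  qed
  ultimately show ?thesis
    using K_compact K_sub(2) by blast
qed

section \<open>Uniform distributions and real codes of points\<close>

text \<open>The probability integral transform. Without atoms the distribution function is
  continuous, so for \<open>u\<close> strictly between 0 and 1 the set where it is at most
  \<open>u\<close> is a half-line of measure \<open>u\<close>.\<close>

lemma (in real_distribution) distr_cdf_uniform:
  assumes atomless: "\<And>x. measure M {x} = 0"
  shows "distr M borel (cdf M) = uniform_measure lborel {0..1}"
proof (rule cdf_unique)
  have mono: "mono (cdf M)"
    by (intro monoI cdf_nondecreasing)
  then have meas[measurable]: "cdf M \<in> borel_measurable borel"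
    by (rule borel_measurable_mono)
  show "real_distribution (distr M borel (cdf M))"
    by (rule real_distribution_distr) simp
  show "real_distribution (uniform_measure lborel {0..1::real})"
    by (auto simp: real_distribution_def real_distribution_axioms_def intro!: prob_space_uniform_measure)
  have cont: "continuous_on UNIV (cdf M)"
    using atomless isCont_cdf by (simp add: continuous_on_eq_continuous_at)
  show "cdf (distr M borel (cdf M)) = cdf (uniform_measure lborel {0..1})"
  proof
    fix u :: real
    define S where "S = {x. cdf M x \<le> u}"
    have "cdf (distr M borel (cdf M)) u = measure M S"
      by (simp add: cdf_def[of "distr M borel (cdf M)"] measure_distr S_def vimage_def)
    also have "\<dots> = measure lborel ({0..1} \<inter> {..u})"
    proof -
      consider "u < 0" | "1 \<le> u" | "0 \<le> u" "u < 1"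
        by linarith
      then show ?thesis
      proof cases
        case 1
        then have "S = {}"
          using order_trans[OF cdf_nonneg] by (fastforce simp: S_def)
        moreover have "{0..1} \<inter> {..u} = {}"
          using 1 by auto
        ultimately show ?thesis
          by simp
      next
        case 2
        then have "S = UNIV"
          using order_trans[OF cdf_bounded_prob] by (fastforce simp: S_def)
        moreover have "{0..1} \<inter> {..u} = {0..1}"
          using 2 by auto
        ultimately show ?thesis
          using prob_space by simp
      next
        case 3
        have rhs: "measure lborel ({0..1} \<inter> {..u}) = u"
        proof -
          have "{0..1} \<inter> {..u} = {0..u}"
            using 3 by auto
          then show ?thesis
            using 3 by simp
        qed
        show ?thesis
        proof (cases "S = {}")
          \<comment> \<open>This occurs only for \<open>u = 0\<close>, when the distribution
            function is positive everywhere: any \<open>u > 0\<close> is undercut near minus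
            infinity.\<close>
          case True
          have "u \<le> 0"
          proof (rule ccontr)
            assume "\<not> u \<le> 0"
            then have "\<forall>\<^sub>F x in at_bot. cdf M x < u"
              by (intro order_tendstoD(2)[OF cdf_lim_at_bot]) simp
            then obtain x where "cdf M x < u"
              by (auto simp: eventually_at_bot_linorder)
            then show False
              using True by (auto simp: S_def dest: less_imp_le)
          qed
          then show ?thesis
            using True 3 rhs by simp
        next
          case False
          have "\<forall>\<^sub>F x in at_top. u < cdf M x"
            using 3 by (intro order_tendstoD(1)[OF cdf_lim_at_top_prob])
          then obtain b where b: "\<And>x. x \<ge> b \<Longrightarrow> u < cdf M x"
            by (auto simp: eventually_at_top_linorder)
          have bdd: "bdd_above S"
          proof (rule bdd_aboveI[of _ b], rule ccontr)
            fix x assume "x \<in> S" "\<not> x \<le> b"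
            then show False
              using b[of x] by (simp add: S_def)
          qed
          have "closed S"
            unfolding S_def using cont by (intro closed_Collect_le) auto
          then have "Sup S \<in> S"
            using closed_contains_Sup[OF False bdd] by blast
          then have le: "cdf M (Sup S) \<le> u"
            by (simp add: S_def)
          \<comment> \<open>A nonempty closed lower set that is bounded above is a closed half-line,
            so its measure is the value of the distribution function at its supremum.\<close>
          have S_eq: "S = {..Sup S}"
          proof (intro set_eqI iffI)
            show "x \<in> {..Sup S}" if "x \<in> S" for x
              using cSup_upper[OF that bdd] by simp
            show "x \<in> S" if "x \<in> {..Sup S}" for x
              using that le cdf_nondecreasing[of x "Sup S"] by (auto simp: S_def)
          qed
          have "u \<le> cdf M (Sup S)"
          proof (rule ccontr)
            assume "\<not> u \<le> cdf M (Sup S)"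
            moreover have "u < cdf M (max b (Sup S))"
              using b by simp
            ultimately obtain x where x: "Sup S \<le> x" "cdf M x = u"
              using IVT'[of "cdf M" "Sup S" u "max b (Sup S)"] cont continuous_on_subset
              by (metis less_imp_le max.cobounded2 not_le subset_UNIV)
            then have "x \<le> Sup S"
              using cSup_upper[OF _ bdd, of x] by (simp add: S_def)
            with x \<open>\<not> u \<le> cdf M (Sup S)\<close> show False
              by simp
          qed
          then have "measure M S = u"
            using le S_eq by (simp add: cdf_def)
          then show ?thesis
            by (simp only: rhs)
        qed
      qed
    qed
    also have "\<dots> = cdf (uniform_measure lborel {0..1}) u"
      unfolding cdf_def by (subst measure_uniform_measure) auto
    finally show "cdf (distr M borel (cdf M)) u = cdf (uniform_measure lborel {0..1}) u" .
  qed
qed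

text \<open>A point is coded by the set of indices of the basic open sets around it, which
  determines the point by separation; sets of naturals are then coded by reals.\<close>

lemma second_countable_inj_real:
  fixes T :: "'a topology"
  assumes "second_countable T" "Hausdorff_space T"
  shows "\<exists>j :: 'a \<Rightarrow> real. inj_on j (topspace T)"
proof -
  obtain \<B> where \<B>: "countable \<B>" "\<And>V. V \<in> \<B> \<Longrightarrow> openin T V"
      "\<And>U x. \<lbrakk>openin T U; x \<in> U\<rbrakk> \<Longrightarrow> \<exists>V\<in>\<B>. x \<in> V \<and> V \<subseteq> U"
    using assms(1) unfolding second_countable_def by metis
  define c where "c x = to_nat_on \<B> ` {V \<in> \<B>. x \<in> V}" for x
  have "inj_on c (topspace T)"
  proof (rule inj_onI, rule ccontr)
    fix x y assume xy: "x \<in> topspace T" "y \<in> topspace T" "c x = c y" "x \<noteq> y"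
    then obtain U W where "openin T U" "openin T W" "x \<in> U" "y \<in> W" "disjnt U W"
      using assms(2) unfolding Hausdorff_space_def by metis
    moreover then obtain V where "V \<in> \<B>" "x \<in> V" "V \<subseteq> U"
      using \<B>(3) by metis
    ultimately have "V \<in> {V \<in> \<B>. x \<in> V}" "V \<notin> {V \<in> \<B>. y \<in> V}"
      by (auto simp: disjnt_iff)
    moreover have "{V \<in> \<B>. x \<in> V} = {V \<in> \<B>. y \<in> V}"
      using xy(3) unfolding c_def
      by (subst (asm) inj_on_image_eq_iff[OF inj_on_to_nat_on[OF \<B>(1)]]) auto
    ultimately show False
      by blast
  qed
  moreover obtain k :: "nat set \<Rightarrow> real" where "bij k"
    using nat_sets_eqpoll_reals unfolding eqpoll_def by blast
  ultimately have "inj_on (k \<circ> c) (topspace T)"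
    by (meson bij_is_inj comp_inj_on inj_on_subset subset_UNIV)
  then show ?thesis
    by blast
qed

text \<open>Closed inner regularity passes from Borel sets to all measurable subsets of the Polish
  space, because the Borel set \<open>A1\<close> inside \<open>A\<close> misses only a part of the
  null set \<open>A2 - A1\<close>.\<close>

lemma standard_prob_space_topology:
  fixes M :: "'a measure"
  assumes "standard_prob_space M"
  obtains T where "completely_metrizable_space T" "second_countable T"
    "space M - topspace T \<in> null_sets M" "\<And>U. openin T U \<Longrightarrow> U \<in> sets M"
    "\<And>A e. \<lbrakk>A \<in> sets M; A \<subseteq> topspace T; e > 0\<rbrakk> \<Longrightarrow>
      \<exists>F. closedin T F \<and> F \<subseteq> A \<and> measure M (A - F) < e"
proof -
  interpret prob_space M
    using assms by (simp add: standard_prob_space_def)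
  obtain T where T: "completely_metrizable_space T" "second_countable T"
      "space M - topspace T \<in> null_sets M"
    and Borel: "sets (sigma (topspace T) {U. openin T U}) \<subseteq> sets M"
    and sandwich: "\<forall>A\<in>sets M. \<exists>A1\<in>sets (sigma (topspace T) {U. openin T U}).
        \<exists>A2\<in>sets (sigma (topspace T) {U. openin T U}).
        A1 \<subseteq> A \<inter> topspace T \<and> A \<inter> topspace T \<subseteq> A2 \<and> emeasure M (A2 - A1) = 0"
    using assms unfolding standard_prob_space_def Let_def by (elim conjE exE) (rule that; assumption)
  have sigma: "sets (sigma (topspace T) {U. openin T U}) = sigma_sets (topspace T) {U. openin T U}"
    by (rule sets_measure_of) (auto dest: openin_subset)
  have open_sets: "U \<in> sets M" if "openin T U" for U
    using Borel that unfolding sigma by auto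
  have "\<exists>F. closedin T F \<and> F \<subseteq> A \<and> measure M (A - F) < e"
    if A: "A \<in> sets M" "A \<subseteq> topspace T" "e > 0" for A e
  proof -
    obtain A1 A2 where A12: "A1 \<in> sigma_sets (topspace T) {U. openin T U}"
        "A2 \<in> sigma_sets (topspace T) {U. openin T U}" "A1 \<subseteq> A" "A \<subseteq> A2" "emeasure M (A2 - A1) = 0"
      using bspec[OF sandwich A(1)] A(2) unfolding sigma by (auto simp: Int_absorb2)
    obtain F where F: "closedin T F" "F \<subseteq> A1" "measure M (A1 - F) < e"
      using closed_inner_regular[OF completely_metrizable_imp_metrizable_space[OF T(1)] open_sets A12(1) \<open>e > 0\<close>]
      by blast
    have [measurable]: "A1 \<in> sets M" "A2 \<in> sets M" "F \<in> sets M"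
      using A12(1,2) Borel closedin_in_sets[OF F(1) open_sets] unfolding sigma by auto
    have "measure M (A - F) \<le> measure M ((A1 - F) \<union> (A2 - A1))"
      using A12 by (intro finite_measure_mono) auto
    also have "\<dots> \<le> measure M (A1 - F) + measure M (A2 - A1)"
      by (intro measure_Un_le) auto
    also have "\<dots> < e"
      using F(3) A12(5) by (simp add: measure_def)
    finally show ?thesis
      using F A12(3) by blast
  qed
  then show thesis
    using that T open_sets by blast
qed

text \<open>Otherwise \<open>f\<close> would give a total extension of Lebesgue measure on the unit interval in which
  every set is inner regular for compact sets, contradicting the existence of Vitali sets.\<close>

lemma null_if_null_fibres:
  fixes M :: "'a measure" and f :: "'a \<Rightarrow> 'b"
  assumes standard: "standard_prob_space M"
    and f: "f \<in> M \<rightarrow>\<^sub>M count_space S" and A: "A \<in> sets M"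
    and fibres: "\<And>s. s \<in> S \<Longrightarrow> measure M (f -` {s} \<inter> A) = 0"
  shows "measure M A = 0"
proof (rule ccontr)
  assume "measure M A \<noteq> 0"
  interpret prob_space M
    using standard by (simp add: standard_prob_space_def)
  obtain T where T: "completely_metrizable_space T" "second_countable T"
    and null: "space M - topspace T \<in> null_sets M"
    and open_sets: "\<And>U. openin T U \<Longrightarrow> U \<in> sets M"
    and inner: "\<And>A e. \<lbrakk>A \<in> sets M; A \<subseteq> topspace T; e > 0\<rbrakk> \<Longrightarrow>
      \<exists>F. closedin T F \<and> F \<subseteq> A \<and> measure M (A - F) < e"
    using standard_prob_space_topology[OF standard] by blast
  define X where "X = topspace T"
  have X[measurable]: "X \<in> sets M"
    unfolding X_def by (rule open_sets[OF openin_topspace])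
  have X_sub: "X \<subseteq> space M"
    by (rule sets.sets_into_space[OF X])
  define B where "B = A \<inter> X"
  have B[measurable]: "B \<in> sets M"
    using A X by (simp add: B_def)
  have "measure M B = measure M (A - (space M - X))"
    using sets.sets_into_space[OF A] by (intro arg_cong[where f = "measure M"]) (auto simp: B_def)
  also have "\<dots> = measure M A"
    using null A by (simp add: measure_Diff_null_set X_def)
  finally have B_pos: "measure M B > 0"
    using \<open>measure M A \<noteq> 0\<close> by (simp add: less_le)
  obtain j :: "'a \<Rightarrow> real" where j: "inj_on j X"
    using second_countable_inj_real[OF T(2)] T(1) completely_metrizable_imp_metrizable_space
      metrizable_imp_Hausdorff_space unfolding X_def by blast
  \<comment> \<open>A vertex is coded by the real code of a chosen preimage in \<open>X\<close>,
    which is injective on the vertices that \<open>f\<close> attains on \<open>X\<close>.\<close>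
  define g where "g s = j (inv_into X f s)" for s
  have g_inj: "f t = f u" if "t \<in> X" "u \<in> X" "g (f t) = g (f u)" for t u
  proof -
    have "inv_into X f (f t) = inv_into X f (f u)"
      using that inj_onD[OF j] by (simp add: g_def inv_into_into)
    then have "f (inv_into X f (f t)) = f (inv_into X f (f u))"
      by (rule arg_cong)
    then show ?thesis
      using that by (simp add: f_inv_into_f)
  qed
  \<comment> \<open>All subsets of \<open>S\<close> are measurable in the discrete space, so any
    real function of the vertex is measurable, however wild the choices behind it.\<close>
  have total: "k \<circ> f \<in> borel_measurable M" for k :: "'b \<Rightarrow> real"
    by (rule measurable_comp[OF f]) simp
  \<comment> \<open>Conditioning on \<open>B\<close> turns null fibres into the absence of atoms for
    a probability distribution \<open>N\<close> on the line.\<close>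
  define U where "U = uniform_measure M B"
  have sets_U[measurable_cong]: "sets U = sets M"
    by (simp add: U_def)
  have B_em: "emeasure M B \<noteq> 0" "emeasure M B \<noteq> \<infinity>"
    using B_pos by (auto simp: emeasure_eq_measure)
  interpret U: prob_space U
    unfolding U_def using B_em by (rule prob_space_uniform_measure)
  have measure_U: "measure U C = measure M (B \<inter> C) / measure M B" if "C \<in> sets M" for C
    unfolding U_def using B_em that by (rule measure_uniform_measure)
  have gf[measurable]: "g \<circ> f \<in> borel_measurable U"
    using total[of g] by (simp add: measurable_cong_sets[OF sets_U refl])
  define N where "N = distr U borel (g \<circ> f)"
  interpret N: real_distribution N
    unfolding N_def by (rule U.real_distribution_distr) simp
  have atomless: "measure N {x} = 0" for x
  proof -
    have pre: "(g \<circ> f) -` {x} \<inter> space M \<in> sets M"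
      using measurable_sets[OF total[of g], of "{x}"] by simp
    have "measure M (B \<inter> ((g \<circ> f) -` {x} \<inter> space M)) = 0"
    proof (cases "B \<inter> ((g \<circ> f) -` {x} \<inter> space M) = {}")
      case False
      then obtain t where "t \<in> B" "t \<in> (g \<circ> f) -` {x}"
        by blast
      then have t: "t \<in> B" "g (f t) = x"
        by simp_all
      have "f t \<in> S"
        using measurable_space[OF f] t(1) sets.sets_into_space[OF B] by auto
      have "f -` {f t} \<inter> A = (f -` {f t} \<inter> space M) \<inter> A"
        using sets.sets_into_space[OF A] by auto
      then have "f -` {f t} \<inter> A \<in> sets M"
        using measurable_sets[OF f, of "{f t}"] \<open>f t \<in> S\<close> A by simp
      moreover have "B \<inter> ((g \<circ> f) -` {x} \<inter> space M) \<subseteq> f -` {f t} \<inter> A"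
        using g_inj t by (auto simp: B_def)
      ultimately have "measure M (B \<inter> ((g \<circ> f) -` {x} \<inter> space M)) \<le> measure M (f -` {f t} \<inter> A)"
        by (rule finite_measure_mono[rotated])
      then show ?thesis
        using fibres[OF \<open>f t \<in> S\<close>] by (simp add: measure_le_0_iff)
    qed simp
    moreover have "measure N {x} = measure U ((g \<circ> f) -` {x} \<inter> space M)"
      unfolding N_def by (subst measure_distr) (simp_all add: U_def)
    ultimately show ?thesis
      using measure_U[OF pre] by simp
  qed
  define h where "h = cdf N \<circ> (g \<circ> f)"
  \<comment> \<open>Since \<open>h\<close> factors through the discrete space, the preimage of any
    set of reals is measurable; this is what admits the sets \<open>V n\<close>.\<close>
  have h_total: "h -` E \<inter> space M \<in> sets M" for E
  proof -
    have "h -` E \<inter> space M = f -` {s \<in> S. cdf N (g s) \<in> E} \<inter> space M"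
      using measurable_space[OF f] by (auto simp: h_def)
    also have "\<dots> \<in> sets M"
      by (rule measurable_sets[OF f]) simp
    finally show ?thesis .
  qed
  have h[measurable]: "h \<in> borel_measurable M"
    by (rule borel_measurableI) (rule h_total)
  have uniform: "distr U borel h = uniform_measure lborel {0..1}"
  proof -
    have "cdf N \<in> borel_measurable borel"
      by (intro borel_measurable_mono monoI N.cdf_nondecreasing)
    then have "distr U borel h = distr N borel (cdf N)"
      unfolding N_def h_def by (subst distr_distr) simp_all
    then show ?thesis
      using N.distr_cdf_uniform[OF atomless] by simp
  qed
  obtain V :: "nat \<Rightarrow> real set" where V: "(\<Union>n. V n) = UNIV"
      "\<And>n C. \<lbrakk>compact C; C \<subseteq> V n\<rbrakk> \<Longrightarrow> emeasure lborel C = 0"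
    using countable_cover_Vitali by blast
  define D where "D n = B \<inter> (h -` V n \<inter> space M)" for n
  have D: "D n \<in> sets M" for n
    unfolding D_def by (intro sets.Int B h_total)
  \<comment> \<open>If \<open>D n\<close> were not null, its own measure could serve as tolerance,
    giving a non-null compact \<open>K\<close> whose image is a compact subset of
    \<open>V n\<close>, hence Lebesgue null. As \<open>h\<close> is uniform on \<open>B\<close>, the
    part of \<open>B\<close> lying over this image is null, but it contains
    \<open>K\<close>.\<close>
  have "measure M (D n) = 0" for n
  proof (rule ccontr)
    assume "measure M (D n) \<noteq> 0"
    then have pos: "measure M (D n) > 0"
      by (simp add: less_le)
    have "D n \<subseteq> topspace T"
      by (auto simp: D_def B_def X_def)
    then obtain K where K: "compactin T K" "K \<subseteq> D n" "compact (h ` K)"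
        "measure M (D n - K) < measure M (D n)"
      using compact_image_inner_regular[OF T open_sets inner h D _ pos] by blast
    have K_sets: "K \<in> sets M"
      using K(1) T(1) open_sets compactin_imp_closedin completely_metrizable_imp_metrizable_space
        metrizable_imp_Hausdorff_space closedin_in_sets by metis
    have "h ` K \<subseteq> V n"
      using K(2) by (auto simp: D_def)
    then have lborel_null: "emeasure lborel (h ` K) = 0"
      by (rule V(2)[OF K(3)])
    have hK: "h ` K \<in> sets borel"
      using K(3) by (rule borel_compact)
    have "emeasure lborel ({0..1} \<inter> h ` K) \<le> emeasure lborel (h ` K)"
      using hK by (intro emeasure_mono) auto
    then have "measure (uniform_measure lborel {0..1}) (h ` K) = 0"
      using hK lborel_null by (simp add: measure_def)
    then have "measure U (h -` (h ` K) \<inter> space M) = 0"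
      unfolding uniform[symmetric] using hK by (subst (asm) measure_distr) (simp_all add: U_def)
    then have "measure M (B \<inter> (h -` (h ` K) \<inter> space M)) = 0"
      using measure_U[OF h_total] B_pos by simp
    moreover have "measure M K \<le> measure M (B \<inter> (h -` (h ` K) \<inter> space M))"
      using K(2) by (intro finite_measure_mono sets.Int B h_total) (auto simp: D_def)
    ultimately have "measure M K = 0"
      by (simp add: measure_le_0_iff)
    moreover have "measure M (D n - K) = measure M (D n) - measure M K"
      by (rule finite_measure_Diff[OF D K_sets K(2)])
    ultimately show False
      using K(4) by simp
  qed
  then have "(\<Union>n. D n) \<in> null_sets M"
    using D by (intro null_sets_UN) (auto simp: null_sets_def emeasure_eq_measure)
  moreover have "(\<Union>n. D n) = B \<inter> (h -` (\<Union>n. V n) \<inter> space M)"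
    by (auto simp: D_def)
  then have "(\<Union>n. D n) = B"
    using V(1) sets.sets_into_space[OF B] by auto
  ultimately show False
    using B_pos by (simp add: measure_def null_sets_def)
qed

text \<open>With real codes for the vertices that \<open>f\<close> takes on \<open>X\<close>,
  disagreement on \<open>X\<close> means that two real measurable functions differ. Off
  \<open>X\<close> there remains some subset of a null set, whence the completion.\<close>

lemma disagreement_in_completion:
  fixes M :: "'a measure" and f g :: "'a \<Rightarrow> 'b"
  assumes standard: "standard_prob_space M"
    and f: "f \<in> M \<rightarrow>\<^sub>M count_space S" and g: "g \<in> M \<rightarrow>\<^sub>M count_space S"
  shows "{t \<in> space M. f t \<noteq> g t} \<in> sets (completion M)"
proof -
  obtain T where T: "completely_metrizable_space T" "second_countable T"
    and null: "space M - topspace T \<in> null_sets M"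
    and open_sets: "\<And>U. openin T U \<Longrightarrow> U \<in> sets M"
    by (rule standard_prob_space_topology[OF standard]) (rule that; assumption)
  define X where "X = topspace T"
  have X: "X \<in> sets M"
    unfolding X_def by (rule open_sets[OF openin_topspace])
  obtain j :: "'a \<Rightarrow> real" where j: "inj_on j X"
    using second_countable_inj_real[OF T(2)] T(1) completely_metrizable_imp_metrizable_space
      metrizable_imp_Hausdorff_space unfolding X_def by blast
  \<comment> \<open>Codes are positive thanks to \<open>exp\<close>, so the default 0 for vertices
    that \<open>f\<close> does not attain on \<open>X\<close> never collides with the code of a
    value attained there.\<close>
  define k where "k s = (if s \<in> f ` X then exp (j (inv_into X f s)) else 0)" for s
  have k: "f t = s" if "t \<in> X" "k (f t) = k s" for t s
  proof -
    have "s \<in> f ` X"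
      using that by (auto simp: k_def split: if_splits)
    then have "inv_into X f (f t) = inv_into X f s"
      using that j by (auto simp: k_def inj_on_eq_iff inv_into_into)
    then have "f (inv_into X f (f t)) = f (inv_into X f s)"
      by (rule arg_cong)
    then show ?thesis
      using \<open>s \<in> f ` X\<close> that(1) by (simp add: f_inv_into_f)
  qed
  have [measurable]: "(\<lambda>t. k (f t)) \<in> borel_measurable M" "(\<lambda>t. k (g t)) \<in> borel_measurable M"
    using measurable_compose[OF f, of k borel] measurable_compose[OF g, of k borel] by simp_all
  have "{t \<in> space M. k (f t) \<noteq> k (g t)} \<in> sets M"
    by measurable
  then have "{t \<in> space M. k (f t) \<noteq> k (g t)} \<inter> X \<in> sets M"
    using X by (rule sets.Int)
  moreover have "{t \<in> space M. f t \<noteq> g t} = {t \<in> space M. k (f t) \<noteq> k (g t)} \<inter> X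
      \<union> {t \<in> space M. f t \<noteq> g t} \<inter> (space M - X)"
    using k by auto
  ultimately show ?thesis
    using null by (intro sets_completionI[of _ "{t \<in> space M. k (f t) \<noteq> k (g t)} \<inter> X" _ "space M - X"])
      (auto simp: X_def)
qed

section \<open>The spaces of random simplices\<close>

locale standard_prob = prob_space M for M :: "'a measure" +
  assumes standard: "standard_prob_space M"
begin

sublocale completed: prob_space "completion M"
  by (rule prob_spaceI) (simp add: emeasure_space_1)

definition cls :: "'v set \<Rightarrow> ('a \<Rightarrow> 'v) \<Rightarrow> ('a \<Rightarrow> 'v) set" where
  "cls S f = ae_rel M S `` {f}"

text \<open>\<open>L_dist\<close> before passing to classes: a pseudometric on measurable maps, free
  of the choices made by \<open>SOME\<close>.\<close>

definition disagreement :: "('a \<Rightarrow> 'v) \<Rightarrow> ('a \<Rightarrow> 'v) \<Rightarrow> real" where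
  "disagreement f g = measure (completion M) {t \<in> space M. f t \<noteq> g t}"

lemma equiv_ae_rel: "equiv (M \<rightarrow>\<^sub>M count_space S) (ae_rel M S)"
proof (rule equivI)
  show "refl_on (M \<rightarrow>\<^sub>M count_space S) (ae_rel M S)"
    by (auto simp: refl_on_def ae_rel_def)
  show "sym (ae_rel M S)"
    by (auto simp: sym_def ae_rel_def eq_commute)
  show "trans (ae_rel M S)"
  proof (rule transI)
    fix f g h assume fg: "(f, g) \<in> ae_rel M S" and gh: "(g, h) \<in> ae_rel M S"
    then have "AE t in M. f t = g t" "AE t in M. g t = h t"
      by (simp_all add: ae_rel_def)
    then have "AE t in M. f t = h t"
      by eventually_elim simp
    then show "(f, h) \<in> ae_rel M S"
      using fg gh by (simp add: ae_rel_def)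
  qed
qed (auto simp: ae_rel_def)

lemma L_setE:
  assumes "P \<in> L_set M S"
  obtains f where "f \<in> M \<rightarrow>\<^sub>M count_space S" "P = cls S f"
  using assms unfolding L_set_def cls_def by (rule quotientE)

lemma cls_in_L_set: "f \<in> M \<rightarrow>\<^sub>M count_space S \<Longrightarrow> cls S f \<in> L_set M S"
  unfolding L_set_def cls_def by (rule quotientI)

lemma mem_cls_iff:
  "f \<in> M \<rightarrow>\<^sub>M count_space S \<Longrightarrow>
    g \<in> cls S f \<longleftrightarrow> g \<in> M \<rightarrow>\<^sub>M count_space S \<and> (AE t in M. f t = g t)"
  by (simp add: cls_def ae_rel_def)

lemma cls_eq_iff:
  "\<lbrakk>f \<in> M \<rightarrow>\<^sub>M count_space S; g \<in> M \<rightarrow>\<^sub>M count_space S\<rbrakk> \<Longrightarrow>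
    cls S f = cls S g \<longleftrightarrow> (AE t in M. f t = g t)"
  unfolding cls_def eq_equiv_class_iff[OF equiv_ae_rel] by (simp add: ae_rel_def)

lemma disagreement_sets:
  "\<lbrakk>f \<in> M \<rightarrow>\<^sub>M count_space S; g \<in> M \<rightarrow>\<^sub>M count_space S\<rbrakk> \<Longrightarrow>
    {t \<in> space M. f t \<noteq> g t} \<in> sets (completion M)"
  by (rule disagreement_in_completion[OF standard])

lemma disagreement_zero_iff:
  assumes "f \<in> M \<rightarrow>\<^sub>M count_space S" "g \<in> M \<rightarrow>\<^sub>M count_space S"
  shows "disagreement f g = 0 \<longleftrightarrow> (AE t in M. f t = g t)"
proof -
  have "(AE t in M. f t = g t) \<longleftrightarrow> (AE t in completion M. f t = g t)"
    by (rule AE_completion_iff[symmetric])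
  also have "\<dots> \<longleftrightarrow> {t \<in> space M. f t \<noteq> g t} \<in> null_sets (completion M)"
    using AE_iff_null[of "completion M" "\<lambda>t. f t = g t"] disagreement_sets[OF assms] by simp
  also have "\<dots> \<longleftrightarrow> disagreement f g = 0"
    using disagreement_sets[OF assms]
    by (simp only: null_sets_def mem_Collect_eq completed.emeasure_eq_measure disagreement_def
        ennreal_eq_0_iff measure_le_0_iff simp_thms)
  finally show ?thesis ..
qed

lemma disagreement_triangle:
  assumes "f \<in> M \<rightarrow>\<^sub>M count_space S" "g \<in> M \<rightarrow>\<^sub>M count_space S" "h \<in> M \<rightarrow>\<^sub>M count_space S"
  shows "disagreement f h \<le> disagreement f g + disagreement g h"
proof -
  have "disagreement f h \<le>
      measure (completion M) ({t \<in> space M. f t \<noteq> g t} \<union> {t \<in> space M. g t \<noteq> h t})"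
    unfolding disagreement_def
    using disagreement_sets[OF assms(1,2)] disagreement_sets[OF assms(2,3)]
    by (intro completed.finite_measure_mono) auto
  also have "\<dots> \<le> disagreement f g + disagreement g h"
    unfolding disagreement_def
    using disagreement_sets[OF assms(1,2)] disagreement_sets[OF assms(2,3)]
    by (rule measure_Un_le)
  finally show ?thesis .
qed

lemma disagreement_commute: "disagreement f g = disagreement g f"
  by (simp add: disagreement_def eq_commute)

text \<open>The representatives picked by \<open>SOME\<close> have disagreement 0 with
  \<open>f\<close> and \<open>g\<close>, so triangle inequalities in both directions remove the
  choice.\<close>

lemma L_dist_cls:
  assumes f: "f \<in> M \<rightarrow>\<^sub>M count_space S" and g: "g \<in> M \<rightarrow>\<^sub>M count_space S"
  shows "L_dist M (cls S f) (cls S g) = disagreement f g"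
proof -
  define f' where "f' = (SOME h. h \<in> cls S f)"
  define g' where "g' = (SOME h. h \<in> cls S g)"
  have "f \<in> cls S f" "g \<in> cls S g"
    using f g by (simp_all add: mem_cls_iff)
  then have "f' \<in> cls S f" "g' \<in> cls S g"
    by (simp_all only: f'_def g'_def some_in_eq) blast+
  then have f': "f' \<in> M \<rightarrow>\<^sub>M count_space S" "disagreement f f' = 0"
    and g': "g' \<in> M \<rightarrow>\<^sub>M count_space S" "disagreement g g' = 0"
    using f g by (simp_all add: mem_cls_iff disagreement_zero_iff)
  have "disagreement f' g' \<le> disagreement f g"
    using disagreement_triangle[OF f'(1) f g'(1)] disagreement_triangle[OF f g g'(1)] f' g'
    by (simp add: disagreement_commute)
  moreover have "disagreement f g \<le> disagreement f' g'"
    using disagreement_triangle[OF f f'(1) g] disagreement_triangle[OF f'(1) g'(1) g] f' g'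
    by (simp add: disagreement_commute)
  ultimately show ?thesis
    by (simp add: L_dist_def disagreement_def f'_def g'_def)
qed

lemma L_dist_le_1: "L_dist M P Q \<le> 1"
  unfolding L_dist_def by (rule completed.prob_le_1)

lemma Metric_space_L: "Metric_space (L_set M S) (L_dist M)"
proof
  show "0 \<le> L_dist M P Q" for P Q :: "('a \<Rightarrow> 'v) set"
    by (simp add: L_dist_def)
  show "L_dist M P Q = L_dist M Q P" for P Q :: "('a \<Rightarrow> 'v) set"
    by (simp add: L_dist_def eq_commute)
  show "L_dist M P Q = 0 \<longleftrightarrow> P = Q" if PQ: "P \<in> L_set M S" "Q \<in> L_set M S" for P Q
  proof -
    obtain f g where "f \<in> M \<rightarrow>\<^sub>M count_space S" "P = cls S f" "g \<in> M \<rightarrow>\<^sub>M count_space S" "Q = cls S g"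
      using L_setE[OF PQ(1)] L_setE[OF PQ(2)] by metis
    then show ?thesis
      by (simp only: L_dist_cls cls_eq_iff disagreement_zero_iff)
  qed
  show "L_dist M P R \<le> L_dist M P Q + L_dist M Q R"
    if PQR: "P \<in> L_set M S" "Q \<in> L_set M S" "R \<in> L_set M S" for P Q R
  proof -
    obtain f g h where "f \<in> M \<rightarrow>\<^sub>M count_space S" "P = cls S f" "g \<in> M \<rightarrow>\<^sub>M count_space S" "Q = cls S g"
      "h \<in> M \<rightarrow>\<^sub>M count_space S" "R = cls S h"
      using L_setE[OF PQR(1)] L_setE[OF PQR(2)] L_setE[OF PQR(3)] by metis
    then show ?thesis
      by (simp only: L_dist_cls disagreement_triangle)
  qed
qed

section \<open>Completeness of the space of classes\<close>

text \<open>Outside \<open>A k\<close>, a set of measure at most \<open>(1/2) ^ k\<close>, the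
  values no longer change from index \<open>k\<close> on. So almost every point has an eventually
  constant value, which defines the limit.\<close>

lemma fast_Cauchy_limit:
  assumes F: "\<And>k. F k \<in> M \<rightarrow>\<^sub>M count_space S"
    and fast: "\<And>k. disagreement (F k) (F (Suc k)) \<le> (1/2) ^ Suc k"
  shows "\<exists>G. G \<in> M \<rightarrow>\<^sub>M count_space S \<and> (\<forall>k. disagreement (F k) G \<le> (1/2) ^ k)"
proof -
  define A where "A k = (\<Union>j. {t \<in> space M. F (k + j) t \<noteq> F (Suc (k + j)) t})" for k
  have A_sets: "A k \<in> sets (completion M)" for k
    unfolding A_def using disagreement_sets[OF F F] by (intro sets.countable_UN) auto
  have A_le: "measure (completion M) (A k) \<le> (1/2) ^ k" for k
    unfolding A_def
  proof (rule completed.measure_UN_le_geometric)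
    fix j
    show "{t \<in> space M. F (k + j) t \<noteq> F (Suc (k + j)) t} \<in> sets (completion M)"
      by (rule disagreement_sets[OF F F])
    show "measure (completion M) {t \<in> space M. F (k + j) t \<noteq> F (Suc (k + j)) t}
        \<le> (1/2) ^ k * (1/2) ^ Suc j"
      using fast[of "k + j"] by (simp add: disagreement_def power_add)
  qed
  have stable: "F l t = F k t" if "t \<in> space M" "t \<notin> A k" "k \<le> l" for t k l
    using that(3)
  proof (induction l rule: dec_induct)
    case (step l)
    have "F (k + (l - k)) t = F (Suc (k + (l - k))) t"
      using that(1,2) unfolding A_def by blast
    then show ?case
      using step by simp
  qed simp
  have "measure (completion M) (\<Inter>k. A k) \<le> 0"
  proof (rule LIMSEQ_le_const)
    show "(\<lambda>k. (1/2 :: real) ^ k) \<longlonglongrightarrow> 0"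
      by (rule LIMSEQ_power_zero) simp
    have "measure (completion M) (\<Inter>k. A k) \<le> (1/2) ^ k" for k
      using completed.finite_measure_mono[OF _ A_sets[of k], of "\<Inter>k. A k"] A_le[of k] by force
    then show "\<exists>N. \<forall>k\<ge>N. measure (completion M) (\<Inter>k. A k) \<le> (1/2) ^ k"
      by blast
  qed
  then have "measure (completion M) (\<Inter>k. A k) = 0"
    by (simp add: measure_le_0_iff)
  moreover have "(\<Inter>k. A k) \<in> sets (completion M)"
    using A_sets by (intro sets.countable_INT) auto
  ultimately have "(\<Inter>k. A k) \<in> null_sets (completion M)"
    by (simp only: null_sets_def mem_Collect_eq completed.emeasure_eq_measure ennreal_0 simp_thms)
  \<comment> \<open>The sets \<open>A k\<close> are known to be measurable only for the completion.
    \<open>N\<close> is a null set of \<open>M\<close> itself around the exceptional points, and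
    \<open>F 0\<close> is the measurable default there.\<close>
  then obtain N where N: "N \<in> null_sets M" "(\<Inter>k. A k) \<subseteq> N"
    unfolding null_sets_completion_iff2 by blast
  define G where "G t = (if t \<in> N then F 0 t else F (SOME k. t \<notin> A k) t)" for t
  have G: "\<exists>k. t \<notin> A k \<and> (\<forall>l\<ge>k. F l t = G t)" if "t \<in> space M" "t \<notin> N" for t
  proof -
    have "\<exists>k. t \<notin> A k"
      using that(2) N(2) by blast
    then have "t \<notin> A (SOME k. t \<notin> A k)"
      by (rule someI_ex)
    moreover have "G t = F (SOME k. t \<notin> A k) t"
      using that(2) by (simp add: G_def)
    ultimately show ?thesis
      using stable[OF that(1)] by metis
  qed
  have "G \<in> M \<rightarrow>\<^sub>M count_space S"
  proof (rule measurableI)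
    show "G t \<in> space (count_space S)" if "t \<in> space M" for t
      using measurable_space[OF F that] by (simp add: G_def)
    show "G -` E \<inter> space M \<in> sets M" if E: "E \<in> sets (count_space S)" for E
    proof -
      have FE: "F k -` E \<inter> space M \<in> sets M" for k
        by (rule measurable_sets[OF F E])
      have N_sets: "N \<in> sets M"
        using N(1) by blast
      have G_mem: "(\<exists>k. \<forall>l\<in>{k..}. F l t \<in> E) \<longleftrightarrow> G t \<in> E" if t: "t \<in> space M" "t \<notin> N" for t
      proof -
        obtain k where k: "\<And>l. l \<ge> k \<Longrightarrow> F l t = G t"
          using G[OF t] by blast
        show ?thesis
        proof
          assume "\<exists>k. \<forall>l\<in>{k..}. F l t \<in> E"
          then obtain k' where "\<forall>l\<in>{k'..}. F l t \<in> E"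
            by blast
          then have "F (max k k') t \<in> E"
            by simp
          then show "G t \<in> E"
            using k[of "max k k'"] by simp
        next
          assume "G t \<in> E"
          then show "\<exists>k. \<forall>l\<in>{k..}. F l t \<in> E"
            using k by (intro exI[of _ k]) simp
        qed
      qed
      \<comment> \<open>Off \<open>N\<close> the preimage under \<open>G\<close> is the lower limit
        of the preimages under \<open>F l\<close>; this expression avoids the sets
        \<open>A k\<close> and stays in \<open>sets M\<close>.\<close>
      have "G -` E \<inter> space M =
          ((\<Union>k. \<Inter>l\<in>{k..}. F l -` E \<inter> space M) - N) \<union> (F 0 -` E \<inter> space M \<inter> N)"
        (is "?L = ?R")
      proof (rule set_eqI)
        fix t
        show "t \<in> ?L \<longleftrightarrow> t \<in> ?R"
        proof (cases "t \<in> space M \<and> t \<notin> N")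
          case True
          then show ?thesis
            using G_mem[of t] by simp
        next
          case False
          moreover have "G t = F 0 t" if "t \<in> N"
            using that by (simp add: G_def)
          ultimately show ?thesis
            by auto
        qed
      qed
      also have "\<dots> \<in> sets M"
      proof (intro sets.Un sets.Diff sets.countable_UN sets.Int[OF FE N_sets] N_sets image_subsetI)
        show "(\<Inter>l\<in>{k..}. F l -` E \<inter> space M) \<in> sets M" for k
          by (rule sets.countable_INT') (use FE in auto)
      qed
      finally show ?thesis .
    qed
  qed
  moreover have "disagreement (F k) G \<le> (1/2) ^ k" for k
  proof -
    have N_completed: "N \<in> null_sets (completion M)"
      using N(1) by (rule null_sets_completionI)
    have "{t \<in> space M. F k t \<noteq> G t} \<subseteq> A k \<union> N"
    proof
      fix t assume "t \<in> {t \<in> space M. F k t \<noteq> G t}"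
      then have t: "t \<in> space M" "F k t \<noteq> G t"
        by auto
      show "t \<in> A k \<union> N"
      proof (rule ccontr)
        assume "t \<notin> A k \<union> N"
        then obtain k' where "\<And>l. l \<ge> k' \<Longrightarrow> F l t = G t"
          using G[OF t(1)] by blast
        then have "F (max k k') t = G t"
          by simp
        moreover have "F (max k k') t = F k t"
          using \<open>t \<notin> A k \<union> N\<close> by (intro stable[OF t(1)]) auto
        ultimately show False
          using t(2) by simp
      qed
    qed
    then have "disagreement (F k) G \<le> measure (completion M) (A k \<union> N)"
      unfolding disagreement_def using A_sets N_completed
      by (intro completed.finite_measure_mono) auto
    also have "\<dots> = measure (completion M) (A k)"
      by (rule measure_Un_null_set[OF A_sets N_completed])
    finally show ?thesis
      using A_le[of k] by simp
  qed
  ultimately show ?thesis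
    by blast
qed

lemma mcomplete_L: "Metric_space.mcomplete (L_set M S) (L_dist M)"
proof -
  interpret L: Metric_space "L_set M S" "L_dist M"
    by (rule Metric_space_L)
  show ?thesis
    unfolding L.mcomplete_def
  proof (intro allI impI)
    fix \<sigma> assume \<sigma>: "L.MCauchy \<sigma>"
    then have range_\<sigma>: "range \<sigma> \<subseteq> L_set M S"
      and small: "\<forall>\<epsilon>>0. \<exists>N. \<forall>n m. N \<le> n \<longrightarrow> N \<le> m \<longrightarrow> L_dist M (\<sigma> n) (\<sigma> m) < \<epsilon>"
      unfolding L.MCauchy_def by (rule conjunct1, rule conjunct2)
    have "\<exists>f. f \<in> M \<rightarrow>\<^sub>M count_space S \<and> \<sigma> n = cls S f" for n
    proof -
      have "\<sigma> n \<in> L_set M S"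
        using range_\<sigma> by blast
      then show ?thesis
        by (rule L_setE) blast
    qed
    then obtain F where F: "\<And>n. F n \<in> M \<rightarrow>\<^sub>M count_space S" "\<And>n. \<sigma> n = cls S (F n)"
      by metis
    have "\<exists>N. \<forall>n m. N \<le> n \<longrightarrow> N \<le> m \<longrightarrow> L_dist M (\<sigma> n) (\<sigma> m) < (1/2) ^ Suc k" for k
      by (rule small[rule_format]) simp
    then obtain N where N: "\<And>k n m. \<lbrakk>n \<ge> N k; m \<ge> N k\<rbrakk> \<Longrightarrow> L_dist M (\<sigma> n) (\<sigma> m) < (1/2) ^ Suc k"
      by metis
    \<comment> \<open>Strictly increasing with \<open>N k \<le> r k\<close>, so that the terms at
      \<open>r k\<close> and \<open>r (Suc k)\<close> are both in the range where distances are
      below \<open>(1/2) ^ Suc k\<close>.\<close>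
    define r where "r = rec_nat (N 0) (\<lambda>k p. max (Suc p) (N (Suc k)))"
    have r_Suc: "r (Suc k) = max (Suc (r k)) (N (Suc k))" for k
      by (simp add: r_def)
    have "strict_mono r"
      by (rule strict_monoI_Suc) (simp add: r_Suc)
    have r_ge: "N k \<le> r k" for k
      by (cases k) (simp_all add: r_def)
    have "disagreement (F (r k)) (F (r (Suc k))) \<le> (1/2) ^ Suc k" for k
    proof -
      have "N k \<le> r (Suc k)"
        using r_ge[of k] by (simp add: r_Suc)
      from N[OF r_ge this] show ?thesis
        by (simp only: F(2) L_dist_cls[OF F(1) F(1)] less_imp_le)
    qed
    then obtain G where G: "G \<in> M \<rightarrow>\<^sub>M count_space S" "\<And>k. disagreement (F (r k)) G \<le> (1/2) ^ k"
      using fast_Cauchy_limit[of "\<lambda>k. F (r k)" S] F(1) by blast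
    have "(\<lambda>k. disagreement (F (r k)) G) \<longlonglongrightarrow> 0"
    proof (rule tendsto_sandwich[OF _ _ tendsto_const])
      show "(\<lambda>k. (1/2 :: real) ^ k) \<longlonglongrightarrow> 0"
        by (rule LIMSEQ_power_zero) simp
      show "\<forall>\<^sub>F k in sequentially. 0 \<le> disagreement (F (r k)) G"
        by (simp add: disagreement_def)
      show "\<forall>\<^sub>F k in sequentially. disagreement (F (r k)) G \<le> (1/2) ^ k"
        using G(2) by (rule always_eventually[OF allI])
    qed
    moreover have "L_dist M ((\<sigma> \<circ> r) k) (cls S G) = disagreement (F (r k)) G" for k
      by (simp only: o_apply F(2) L_dist_cls[OF F(1) G(1)])
    moreover have "(\<sigma> \<circ> r) k \<in> L_set M S" for k
      by (simp only: o_apply F(2) cls_in_L_set[OF F(1)])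
    ultimately have "limitin L.mtopology (\<sigma> \<circ> r) (cls S G) sequentially"
      unfolding L.limitin_metric_dist_null using cls_in_L_set[OF G(1)] by simp
    then show "\<exists>P. limitin L.mtopology \<sigma> P sequentially"
      using L.MCauchy_convergent_subsequence[OF \<sigma> \<open>strict_mono r\<close>] by blast
  qed
qed

section \<open>Essential images\<close>

lemma fibre_sets:
  assumes "f \<in> M \<rightarrow>\<^sub>M count_space S"
  shows "f -` {s} \<inter> space M \<in> sets M"
proof -
  have "f -` {s} \<inter> space M = f -` ({s} \<inter> S) \<inter> space M"
    using measurable_space[OF assms] by auto
  then show ?thesis
    using measurable_sets[OF assms, of "{s} \<inter> S"] by simp
qed

text \<open>The part of the domain mapped outside the essential image has only null fibres, though
  possibly uncountably many; \<open>null_if_null_fibres\<close> makes it null.\<close>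

lemma AE_in_ess_image:
  assumes f: "f \<in> M \<rightarrow>\<^sub>M count_space S"
  shows "AE t in M. f t \<in> ess_image M f"
proof -
  define A where "A = f -` (S - ess_image M f) \<inter> space M"
  have A: "A \<in> sets M"
    unfolding A_def by (rule measurable_sets[OF f]) simp
  have "measure M A = 0"
  proof (rule null_if_null_fibres[OF standard f A])
    fix s assume "s \<in> S"
    show "measure M (f -` {s} \<inter> A) = 0"
    proof (cases "s \<in> ess_image M f")
      case True
      then have "f -` {s} \<inter> A = {}"
        by (auto simp: A_def)
      then show ?thesis
        by simp
    next
      case False
      then have "f -` {s} \<inter> A = f -` {s} \<inter> space M"
        using \<open>s \<in> S\<close> by (auto simp: A_def)
      then show ?thesis
        using False by (simp add: ess_image_def not_less measure_le_0_iff)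
    qed
  qed
  then have "A \<in> null_sets M"
    using A by (simp add: null_sets_def emeasure_eq_measure)
  moreover have "{t \<in> space M. f t \<notin> ess_image M f} \<subseteq> A"
    using measurable_space[OF f] by (auto simp: A_def)
  ultimately show ?thesis
    by (rule AE_I')
qed

text \<open>This makes the existential condition in \<open>L_complex\<close> independent of the
  representative.\<close>

lemma ess_image_AE_cong:
  assumes f: "f \<in> M \<rightarrow>\<^sub>M count_space S" and g: "g \<in> M \<rightarrow>\<^sub>M count_space S"
    and eq: "AE t in M. f t = g t"
  shows "ess_image M f = ess_image M g"
proof -
  have "measure M (f -` {s} \<inter> space M) = measure M (g -` {s} \<inter> space M)" for s
    using eq by (intro finite_measure_eq_AE fibre_sets[OF f] fibre_sets[OF g]) auto
  then show ?thesis
    by (simp add: ess_image_def)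
qed

lemma measurable_postcompose:
  assumes "\<phi> \<in> S1 \<rightarrow> S2" and "f \<in> M \<rightarrow>\<^sub>M count_space S1"
  shows "\<phi> \<circ> f \<in> M \<rightarrow>\<^sub>M count_space S2"
  using assms by (intro measurable_comp[of f M "count_space S1"]) simp_all

text \<open>The inclusion from left to right rests on \<open>AE_in_ess_image\<close>, which excludes
  a non-null fibre of \<open>\<phi> \<circ> f\<close> that is an uncountable union of null fibres of
  \<open>f\<close>. The other inclusion is monotonicity.\<close>

lemma ess_image_postcompose:
  assumes \<phi>: "\<phi> \<in> S1 \<rightarrow> S2" and f: "f \<in> M \<rightarrow>\<^sub>M count_space S1"
  shows "ess_image M (\<phi> \<circ> f) = \<phi> ` ess_image M f"
proof (rule antisym; rule subsetI)
  fix u assume u: "u \<in> ess_image M (\<phi> \<circ> f)"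
  show "u \<in> \<phi> ` ess_image M f"
  proof (rule ccontr)
    assume *: "u \<notin> \<phi> ` ess_image M f"
    from AE_in_ess_image[OF f] have "AE t in M. \<phi> (f t) \<noteq> u"
      by eventually_elim (use * in blast)
    then have "measure M ((\<phi> \<circ> f) -` {u} \<inter> space M) = measure M {}"
      by (intro finite_measure_eq_AE fibre_sets[OF measurable_postcompose[OF \<phi> f]]) auto
    with u show False
      by (simp add: ess_image_def)
  qed
next
  fix u assume "u \<in> \<phi> ` ess_image M f"
  then obtain s where s: "u = \<phi> s" "0 < measure M (f -` {s} \<inter> space M)"
    by (auto simp: ess_image_def)
  have "measure M (f -` {s} \<inter> space M) \<le> measure M ((\<phi> \<circ> f) -` {u} \<inter> space M)"
    by (intro finite_measure_mono fibre_sets[OF measurable_postcompose[OF \<phi> f]]) (auto simp: s)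
  with s(2) show "u \<in> ess_image M (\<phi> \<circ> f)"
    unfolding ess_image_def by simp
qed

section \<open>The action of vertex maps on classes\<close>

text \<open>Equality almost everywhere survives composition, so the union of classes behind
  \<open>postcompose\<close> is a single class; \<open>f\<close> itself shows that the union is not
  empty.\<close>

lemma postcompose_cls:
  assumes \<phi>: "\<phi> \<in> S1 \<rightarrow> S2" and f: "f \<in> M \<rightarrow>\<^sub>M count_space S1"
  shows "postcompose M S2 \<phi> (cls S1 f) = cls S2 (\<phi> \<circ> f)"
proof -
  have "ae_rel M S2 `` {\<phi> \<circ> g} = cls S2 (\<phi> \<circ> f)" if "g \<in> cls S1 f" for g
  proof -
    have g: "g \<in> M \<rightarrow>\<^sub>M count_space S1" "AE t in M. f t = g t"
      using that f by (simp_all add: mem_cls_iff)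
    then have "AE t in M. (\<phi> \<circ> g) t = (\<phi> \<circ> f) t"
      by auto
    then show ?thesis
      using cls_eq_iff[OF measurable_postcompose[OF \<phi> g(1)] measurable_postcompose[OF \<phi> f]]
      by (simp add: cls_def)
  qed
  moreover have "f \<in> cls S1 f"
    using f by (simp add: mem_cls_iff)
  moreover have "postcompose M S2 \<phi> (cls S1 f) = (\<Union>g\<in>cls S1 f. ae_rel M S2 `` {\<phi> \<circ> g})"
    unfolding postcompose_def by blast
  ultimately show ?thesis
    by auto
qed

lemma postcompose_in_L_set:
  assumes "\<phi> \<in> S1 \<rightarrow> S2" "P \<in> L_set M S1"
  shows "postcompose M S2 \<phi> P \<in> L_set M S2"
proof -
  obtain f where f: "f \<in> M \<rightarrow>\<^sub>M count_space S1" "P = cls S1 f"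
    using assms(2) by (rule L_setE)
  show ?thesis
    unfolding f(2) postcompose_cls[OF assms(1) f(1)]
    by (rule cls_in_L_set[OF measurable_postcompose[OF assms(1) f(1)]])
qed

lemma postcompose_contracting:
  assumes \<phi>: "\<phi> \<in> S1 \<rightarrow> S2" and P: "P \<in> L_set M S1" and Q: "Q \<in> L_set M S1"
  shows "L_dist M (postcompose M S2 \<phi> P) (postcompose M S2 \<phi> Q) \<le> L_dist M P Q"
proof -
  obtain f where f: "f \<in> M \<rightarrow>\<^sub>M count_space S1" "P = cls S1 f"
    using P by (rule L_setE)
  obtain g where g: "g \<in> M \<rightarrow>\<^sub>M count_space S1" "Q = cls S1 g"
    using Q by (rule L_setE)
  have "disagreement (\<phi> \<circ> f) (\<phi> \<circ> g) \<le> disagreement f g"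
    unfolding disagreement_def
    using disagreement_sets[OF f(1) g(1)] by (intro completed.finite_measure_mono) auto
  then show ?thesis
    unfolding f(2) g(2) postcompose_cls[OF \<phi> f(1)] postcompose_cls[OF \<phi> g(1)]
      L_dist_cls[OF f(1) g(1)]
      L_dist_cls[OF measurable_postcompose[OF \<phi> f(1)] measurable_postcompose[OF \<phi> g(1)]] .
qed

lemma postcompose_id:
  assumes P: "P \<in> L_set M S"
  shows "postcompose M S (restrict id S) P = P"
proof -
  obtain f where f: "f \<in> M \<rightarrow>\<^sub>M count_space S" "P = cls S f"
    using P by (rule L_setE)
  have id: "restrict id S \<in> S \<rightarrow> S"
    by auto
  have "AE t in M. (restrict id S \<circ> f) t = f t"
    using measurable_space[OF f(1)] by (intro AE_I2) simp
  then show ?thesis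
    unfolding f(2) postcompose_cls[OF id f(1)]
    by (simp only: cls_eq_iff[OF measurable_postcompose[OF id f(1)] f(1)])
qed

lemma postcompose_compose:
  assumes \<phi>: "\<phi> \<in> S1 \<rightarrow> S2" and \<psi>: "\<psi> \<in> S2 \<rightarrow> S3" and P: "P \<in> L_set M S1"
  shows "postcompose M S3 (compose S1 \<psi> \<phi>) P = postcompose M S3 \<psi> (postcompose M S2 \<phi> P)"
proof -
  obtain f where f: "f \<in> M \<rightarrow>\<^sub>M count_space S1" "P = cls S1 f"
    using P by (rule L_setE)
  have comp: "compose S1 \<psi> \<phi> \<in> S1 \<rightarrow> S3"
    using \<phi> \<psi> by (auto simp: compose_def)
  have \<phi>f: "\<phi> \<circ> f \<in> M \<rightarrow>\<^sub>M count_space S2"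
    by (rule measurable_postcompose[OF \<phi> f(1)])
  have "AE t in M. (compose S1 \<psi> \<phi> \<circ> f) t = (\<psi> \<circ> (\<phi> \<circ> f)) t"
    using measurable_space[OF f(1)] by (intro AE_I2) (simp add: compose_def)
  then show ?thesis
    unfolding f(2) postcompose_cls[OF \<phi> f(1)] postcompose_cls[OF \<psi> \<phi>f] postcompose_cls[OF comp f(1)]
    by (simp only: cls_eq_iff[OF measurable_postcompose[OF comp f(1)] measurable_postcompose[OF \<psi> \<phi>f]])
qed

section \<open>Random simplices, their closure and functoriality\<close>

lemma L_complex_subset: "L_complex M K \<subseteq> L_set M (\<Union>K)"
  by (auto simp: L_complex_def)

lemma Submetric_L: "Submetric (L_set M (\<Union>K)) (L_dist M) (L_complex M K)"
  by (intro Submetric.intro Submetric_axioms.intro Metric_space_L L_complex_subset)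

lemma Lbar_complex_subset: "Lbar_complex M K \<subseteq> L_set M (\<Union>K)"
  unfolding Lbar_complex_def Metric_space.metric_closure_of[OF Metric_space_L] by blast

lemma L_complex_subset_Lbar: "L_complex M K \<subseteq> Lbar_complex M K"
  unfolding Lbar_complex_def
  by (rule closure_of_subset) (simp add: Metric_space.topspace_mtopology[OF Metric_space_L] L_complex_subset)

lemma Simp_hom_funcset: "\<phi> \<in> cat_hom Simp K1 K2 \<Longrightarrow> \<phi> \<in> \<Union>K1 \<rightarrow> \<Union>K2"
  by (auto simp: Simp_def)

lemma postcompose_L_complex:
  assumes \<phi>: "\<phi> \<in> cat_hom Simp K1 K2" and P: "P \<in> L_complex M K1"
  shows "postcompose M (\<Union>K2) \<phi> P \<in> L_complex M K2"
proof -
  obtain f where f: "f \<in> M \<rightarrow>\<^sub>M count_space (\<Union>K1)" "P = cls (\<Union>K1) f"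
    using P L_complex_subset by (blast elim: L_setE)
  obtain g where g: "g \<in> P" "ess_image M g \<in> K1"
    using P by (auto simp: L_complex_def)
  have "g \<in> M \<rightarrow>\<^sub>M count_space (\<Union>K1)" "AE t in M. f t = g t"
    using g(1) f(1) unfolding f(2) by (simp_all add: mem_cls_iff)
  then have "ess_image M f \<in> K1"
    using ess_image_AE_cong[OF f(1)] g(2) by simp
  then have ess: "ess_image M (\<phi> \<circ> f) \<in> K2"
    using \<phi> ess_image_postcompose[OF Simp_hom_funcset[OF \<phi>] f(1)] by (auto simp: Simp_def)
  have meas: "\<phi> \<circ> f \<in> M \<rightarrow>\<^sub>M count_space (\<Union>K2)"
    by (rule measurable_postcompose[OF Simp_hom_funcset[OF \<phi>] f(1)])
  have "\<phi> \<circ> f \<in> cls (\<Union>K2) (\<phi> \<circ> f)"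
    using meas by (simp add: mem_cls_iff)
  then show ?thesis
    unfolding f(2) postcompose_cls[OF Simp_hom_funcset[OF \<phi>] f(1)] L_complex_def
    using ess cls_in_L_set[OF meas] by blast
qed

text \<open>A contraction sends approximations of \<open>P\<close> by random simplices to
  approximations of the image that are at least as good.\<close>

lemma postcompose_Lbar_complex:
  assumes \<phi>: "\<phi> \<in> cat_hom Simp K1 K2" and P: "P \<in> Lbar_complex M K1"
  shows "postcompose M (\<Union>K2) \<phi> P \<in> Lbar_complex M K2"
proof -
  interpret L1: Metric_space "L_set M (\<Union>K1)" "L_dist M"
    by (rule Metric_space_L)
  interpret L2: Metric_space "L_set M (\<Union>K2)" "L_dist M"
    by (rule Metric_space_L)
  note \<phi>' = Simp_hom_funcset[OF \<phi>]
  have P_L: "P \<in> L_set M (\<Union>K1)"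
    using P Lbar_complex_subset by blast
  have "\<exists>Q\<in>L_complex M K2. Q \<in> L2.mball (postcompose M (\<Union>K2) \<phi> P) r" if r: "r > 0" for r
  proof -
    obtain R where R: "R \<in> L_complex M K1" "R \<in> L1.mball P r"
      using P r unfolding Lbar_complex_def L1.metric_closure_of by blast
    have R_L: "R \<in> L_set M (\<Union>K1)"
      using R(1) L_complex_subset by blast
    have "L_dist M (postcompose M (\<Union>K2) \<phi> P) (postcompose M (\<Union>K2) \<phi> R) < r"
      using postcompose_contracting[OF \<phi>' P_L R_L] R(2) by simp
    then show ?thesis
      using postcompose_L_complex[OF \<phi> R(1)] postcompose_in_L_set[OF \<phi>' P_L]
        postcompose_in_L_set[OF \<phi>' R_L] by (intro bexI) simp_all
  qed
  then show ?thesis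
    unfolding Lbar_complex_def L2.metric_closure_of
    using postcompose_in_L_set[OF \<phi>' P_L] by blast
qed

text \<open>Both functors restrict one action on \<open>L_set\<close> to a family \<open>Y\<close>
  of invariant subspaces, so the functor laws are shown once, from those of
  \<open>postcompose\<close>.\<close>

lemma is_functor_postcompose:
  fixes Y :: "'v set set \<Rightarrow> ('a \<Rightarrow> 'v) set set"
  assumes Y: "\<And>K. Y K \<subseteq> L_set M (\<Union>K)"
    and closed: "\<And>K1 K2 \<phi> P. \<lbrakk>\<phi> \<in> cat_hom Simp K1 K2; P \<in> Y K1\<rbrakk> \<Longrightarrow> postcompose M (\<Union>K2) \<phi> P \<in> Y K2"
  shows "is_functor Simp Met1
    \<lparr> fun_ob = (\<lambda>K. (Y K, L_dist M)),
      fun_mor = (\<lambda>K1 K2 \<phi>. restrict (postcompose M (\<Union>K2) \<phi>) (Y K1)) \<rparr>"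
  unfolding is_functor_def functr.simps
proof (intro conjI ballI category_Simp category_Met1)
  fix K :: "'v set set"
  show "(Y K, L_dist M) \<in> cat_ob Met1"
    using Metric_space.subspace[OF Metric_space_L Y[of K]] by (simp add: Met1_def L_dist_le_1)
  have "postcompose M (\<Union>K) (restrict id (\<Union>K)) P = P" if "P \<in> Y K" for P
    using that Y by (intro postcompose_id) blast
  then show "restrict (postcompose M (\<Union>K) (cat_id Simp K)) (Y K) = cat_id Met1 (Y K, L_dist M)"
    by (simp add: Simp_def Met1_def fun_eq_iff)
next
  fix K1 K2 :: "'v set set" and \<phi> assume \<phi>: "\<phi> \<in> cat_hom Simp K1 K2"
  have "L_dist M (postcompose M (\<Union>K2) \<phi> P) (postcompose M (\<Union>K2) \<phi> Q) \<le> L_dist M P Q"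
    if "P \<in> Y K1" "Q \<in> Y K1" for P Q
    using that Y by (intro postcompose_contracting[OF Simp_hom_funcset[OF \<phi>]]) blast+
  then show "restrict (postcompose M (\<Union>K2) \<phi>) (Y K1) \<in> cat_hom Met1 (Y K1, L_dist M) (Y K2, L_dist M)"
    using closed[OF \<phi>] by (auto simp: Met1_def contracting_maps_def)
next
  fix K1 K2 K3 :: "'v set set" and \<phi> \<psi>
  assume \<phi>: "\<phi> \<in> cat_hom Simp K1 K2" and \<psi>: "\<psi> \<in> cat_hom Simp K2 K3"
  have "postcompose M (\<Union>K3) (compose (\<Union>K1) \<psi> \<phi>) P
      = postcompose M (\<Union>K3) \<psi> (postcompose M (\<Union>K2) \<phi> P)" if "P \<in> Y K1" for P
    using that Y by (intro postcompose_compose[OF Simp_hom_funcset[OF \<phi>] Simp_hom_funcset[OF \<psi>]]) blast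
  then show "restrict (postcompose M (\<Union>K3) (cat_comp Simp K1 K2 K3 \<psi> \<phi>)) (Y K1) =
      cat_comp Met1 (Y K1, L_dist M) (Y K2, L_dist M) (Y K3, L_dist M)
        (restrict (postcompose M (\<Union>K3) \<psi>) (Y K2)) (restrict (postcompose M (\<Union>K2) \<phi>) (Y K1))"
    using closed[OF \<phi>] by (simp add: Simp_def Met1_def fun_eq_iff compose_def)
qed

lemma is_functor_L: "is_functor Simp Met1 (L_functor M)"
  unfolding L_functor_def by (rule is_functor_postcompose[OF L_complex_subset postcompose_L_complex])

lemma is_functor_Lbar: "is_functor (Simp :: ('v set set, 'v \<Rightarrow> 'v) cat) CMet1 (Lbar_functor M)"
proof -
  have "is_functor (Simp :: ('v set set, 'v \<Rightarrow> 'v) cat) Met1 (Lbar_functor M)"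
    unfolding Lbar_functor_def
    by (rule is_functor_postcompose[OF Lbar_complex_subset postcompose_Lbar_complex])
  moreover have "Metric_space.mcomplete (Lbar_complex M K) (L_dist M)" for K :: "'v set set"
  proof -
    interpret L: Submetric "L_set M (\<Union>K)" "L_dist M" "Lbar_complex M K"
      by (intro Submetric.intro Submetric_axioms.intro Metric_space_L Lbar_complex_subset)
    have "closedin L.mtopology (Lbar_complex M K)"
      by (simp add: Lbar_complex_def)
    then show ?thesis
      using L.closedin_mcomplete_imp_mcomplete mcomplete_L by blast
  qed
  ultimately show ?thesis
    by (intro is_functor_CMet1) (simp_all add: Lbar_functor_def)
qed

end

theorem proposition1p2:
  fixes M :: "'a measure"
  assumes "standard_prob_space M" and "nonatomic M"
  shows "is_functor (Simp :: ('v set set, 'v \<Rightarrow> 'v) cat) Met1 (L_functor M) \<and>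
    is_functor (Simp :: ('v set set, 'v \<Rightarrow> 'v) cat) CMet1 (Lbar_functor M) \<and>
    is_functor (Simp :: ('v set set, 'v \<Rightarrow> 'v) cat) CMet1
      (functor_comp completion_functor (L_functor M)) \<and>
    (\<exists>\<theta>. natural_isometry (Simp :: ('v set set, 'v \<Rightarrow> 'v) cat)
            (functor_comp completion_functor (L_functor M)) (Lbar_functor M) \<theta> \<and>
         (\<forall>K\<in>cat_ob Simp. \<forall>P\<in>L_complex M K.
            \<theta> K (completion_embedding (fun_ob (L_functor M) K) P) = P))"
proof -
  interpret standard_prob M
    using assms(1) by (auto simp: standard_prob_def standard_prob_axioms_def standard_prob_space_def)
  define F where "F = (Lbar_functor M :: ('v set set, 'v \<Rightarrow> 'v, _, _) functr)"
  define G where "G = functor_comp completion_functor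
    (L_functor M :: ('v set set, 'v \<Rightarrow> 'v, ('a \<Rightarrow> 'v) set mspc, _) functr)"
  \<comment> \<open>\<open>s K\<close> sends a point of the closure to the class of all sequences of
    random simplices converging to it; it is the isometry along which the completion is
    computed.\<close>
  define s where "s K = Submetric.seqs_to (L_set M (\<Union>K)) (L_dist M) (L_complex M K)"
    for K :: "'v set set"
  have obF: "fun_ob F K = (Lbar_complex M K, L_dist M)" for K
    by (simp add: F_def Lbar_functor_def)
  have obG: "fun_ob G K = (completion_points (L_complex M K, L_dist M),
      completion_dist (L_complex M K, L_dist M))" for K
    by (simp add: G_def functor_comp_def completion_functor_def L_functor_def)
  have functor_F: "is_functor Simp CMet1 F"
    unfolding F_def by (rule is_functor_Lbar)
  have inj: "inj_on (s K) (fst (fun_ob F K))" for K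
    unfolding s_def obF fst_conv Lbar_complex_def
    by (rule Submetric.inj_on_seqs_to[OF Submetric_L])
  have pts: "fst (fun_ob G K) = s K ` fst (fun_ob F K)" for K
    unfolding s_def obF obG fst_conv Lbar_complex_def
    by (rule Submetric.completion_points_eq[OF Submetric_L mcomplete_L])
  have dist: "snd (fun_ob G K) (s K P) (s K Q) = snd (fun_ob F K) P Q"
    if "P \<in> fst (fun_ob F K)" "Q \<in> fst (fun_ob F K)" for K P Q
    using that unfolding s_def obF obG fst_conv snd_conv Lbar_complex_def
    by (rule Submetric.completion_dist_seqs_to[OF Submetric_L mcomplete_L])
  have out: "snd (fun_ob G K) p q = 0" if "p \<notin> fst (fun_ob G K) \<or> q \<notin> fst (fun_ob G K)" for K p q
    using that by (auto simp: obG completion_dist_def)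
  have ext: "fun_mor G K1 K2 \<phi> \<in> extensional (fst (fun_ob G K1))" for K1 K2 \<phi>
    by (simp add: obG) (simp add: G_def functor_comp_def completion_functor_def L_functor_def)
  have mor: "fun_mor G K1 K2 \<phi> (s K1 P) = s K2 (fun_mor F K1 K2 \<phi> P)"
    if \<phi>: "\<phi> \<in> cat_hom Simp K1 K2" and P: "P \<in> fst (fun_ob F K1)" for K1 K2 \<phi> P
  proof -
    have P': "P \<in> Lbar_complex M K1"
      using P by (simp add: obF)
    have "s K1 P \<in> completion_points (L_complex M K1, L_dist M)"
      using pts[of K1] P by (simp add: obG)
    then have "fun_mor G K1 K2 \<phi> (s K1 P) = cauchy_rel (L_complex M K2, L_dist M) ``
        ((\<lambda>\<sigma>. restrict (postcompose M (\<Union>K2) \<phi>) (L_complex M K1) \<circ> \<sigma>) ` s K1 P)"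
      by (simp add: G_def functor_comp_def completion_functor_def L_functor_def)
    \<comment> \<open>The action on the whole of \<open>L_set\<close> is the contraction that
      extends the action on random simplices to the limit \<open>P\<close>.\<close>
    also have "\<dots> = s K2 (postcompose M (\<Union>K2) \<phi> P)"
      unfolding s_def
    proof (rule completion_action_seqs_to[OF Submetric_L Submetric_L mcomplete_L])
      show "restrict (postcompose M (\<Union>K2) \<phi>) (L_complex M K1) ` L_complex M K1 \<subseteq> L_complex M K2"
        using postcompose_L_complex[OF \<phi>] by auto
      show "postcompose M (\<Union>K2) \<phi> ` L_set M (\<Union>K1) \<subseteq> L_set M (\<Union>K2)"
        using postcompose_in_L_set[OF Simp_hom_funcset[OF \<phi>]] by auto
      show "L_dist M (postcompose M (\<Union>K2) \<phi> a) (postcompose M (\<Union>K2) \<phi> b) \<le> L_dist M a b"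
        if "a \<in> L_set M (\<Union>K1)" "b \<in> L_set M (\<Union>K1)" for a b
        using that by (rule postcompose_contracting[OF Simp_hom_funcset[OF \<phi>]])
      show "P \<in> Metric_space.mtopology (L_set M (\<Union>K1)) (L_dist M) closure_of L_complex M K1"
        using P' by (simp add: Lbar_complex_def)
    qed simp
    finally show ?thesis
      using P' by (simp add: F_def Lbar_functor_def)
  qed
  \<comment> \<open>A class of Cauchy sequences goes to its limit; in particular the class of the
    constant sequence at \<open>P\<close> goes back to \<open>P\<close>.\<close>
  define \<theta> where "\<theta> K = restrict (the_inv_into (fst (fun_ob F K)) (s K)) (fst (fun_ob G K))" for K
  have "natural_isometry Simp G F \<theta>"
    unfolding \<theta>_def by (rule natural_isometry_transport[OF functor_F inj pts dist mor])
  moreover have "\<theta> K (completion_embedding (fun_ob (L_functor M) K) P) = P" if P: "P \<in> L_complex M K" for K P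
  proof -
    have "P \<in> fst (fun_ob F K)"
      using P L_complex_subset_Lbar by (auto simp: obF)
    moreover have "completion_embedding (fun_ob (L_functor M) K) P = s K P"
      using Submetric.completion_embedding_eq[OF Submetric_L mcomplete_L P]
      by (simp add: s_def L_functor_def)
    ultimately show ?thesis
      by (simp add: \<theta>_def pts the_inv_into_f_f[OF inj])
  qed
  moreover have "is_functor Simp CMet1 G"
    by (rule is_functor_transport[OF functor_F inj pts dist out ext mor])
  ultimately show ?thesis
    using is_functor_L functor_F unfolding F_def G_def by blast
qed

end
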